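(* The conics $C_0,\dots,C_3$ are the following intersections of $\mathbb G(1,3)$ with planes in $\mathbb P(\wedge^2A_1^* )=\mathbb P^5$: $C_0=\mathbb G(1,3)\cap\{z_{23}+\alpha z_{01}=z_{13}-\beta z_{02}=z_{12}+\gamma z_{03}=0\}$; $C_1=\mathbb G(1,3)\cap\{z_{23}-\alpha z_{01}=z_{13}+z_{02}=z_{12}+z_{03}=0\}$; $C_2=\mathbb G(1,3)\cap\{z_{23}+z_{01}=z_{13}+\beta z_{02}=z_{12}-z_{03}=0\}$; $C_3=\mathbb G(1,3)\cap\{z_{23}-z_{01}=z_{13}-z_{02}=z_{12}-\gamma z_{03}=0\}$. For each $j\in\{0,1,2,3\}$ the lines in $\mathbb P(A_1^* )$ that correspond to the points on $C_j$ provide a ruling on the quadric $Q_j$, where $Q_0$: $y_0^2+\beta\gamma y_1^2+\gamma\alpha y_2^2+\alpha\beta y_3^2=0$; $Q_1$: $y_0^2-y_1^2-\alpha y_2^2+\alpha y_3^2=0$; $Q_2$: $y_0^2+\beta y_1^2-y_2^2-\beta y_3^2=0$; $Q_3$: $y_0^2-\gamma y_1^2+\gamma y_2^2-y_3^2=0$. Further, $\mathfrak P-(\mathfrak P_\infty\cup\mathfrak P_j)\subseteq Q_j$ and each point in $\mathfrak P-(\mathfrak P_\infty\cup\mathfrak P_j)$ lies on a unique line belonging to $C_j$.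
   Context: Let $k$ be an algebraically closed field of characteristic $\neq2,3$; $\alpha_1,\alpha_2,\alpha_3\in k\setminus\{0,1,-1\}$ with $\alpha_1+\alpha_2+\alpha_3+\alpha_1\alpha_2\alpha_3=0$; $\alpha=\alpha_1,\beta=\alpha_2,\gamma=\alpha_3$; fix $a,b,c,\mathbf i\in k$ with $a^2=\alpha,b^2=\beta,c^2=\gamma,\mathbf i^2=-1$. $A$ is the graded algebra generated by $y_0,\dots,y_3$ (degree 1) with relations $y_0y_i-y_iy_0=\alpha_i(y_jy_k-y_ky_j)$, $y_0y_i+y_iy_0=y_jy_k+y_ky_j$ for all cyclic permutations $(i,j,k)$ of $(1,2,3)$. $\mathbb G(1,3)$ is the Grassmannian of lines in $\mathbb P(A_1^* )$, embedded in $\mathbb P^5$ by the Plücker coordinates $z_{rs}=\lambda_r\lambda_s'-\lambda_r'\lambda_s$ of the line $\sum\lambda_jy_j=\sum\lambda_j'y_j=0$. A 2-dimensional subspace $U=ky+ky'$ of $A_1$ is commuting if $yy'=y'y$ in $A$. $C_0\subseteq\mathbb G(1,3)$ is the set of lines $\{U=0\}\subseteq\mathbb P(A_1^* )$ with $U$ a commuting subspace. For $j=1,2,3$, $C_j$ is the set of lines $\{\psi_j(U)=0\}$ with $U$ a commuting subspace, where $\psi_j:A_1\to A_1$ is the linear automorphism $\psi_1$: $y_0\mapsto\mathbf ibc\,y_1$, $y_1\mapsto-y_0$, $y_2\mapsto-b\,y_3$, $y_3\mapsto-\mathbf ic\,y_2$; $\psi_2$: $y_0\mapsto\mathbf iac\,y_2$,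 $y_1\mapsto\mathbf ia\,y_3$, $y_2\mapsto-y_0$, $y_3\mapsto c\,y_1$; $\psi_3$: $y_0\mapsto ab\,y_3$, $y_1\mapsto-\mathbf ia\,y_2$, $y_2\mapsto-b\,y_1$, $y_3\mapsto-\mathbf i\,y_0$. (Thus $C_j$ is the image of $C_0$ under the auto-equivalence of graded $A$-modules induced by a 4-torsion point $\varepsilon_j$.) In coordinates $(y_0,y_1,y_2,y_3)$, $\mathfrak P=\mathfrak P_\infty\cup\mathfrak P_0\cup\mathfrak P_1\cup\mathfrak P_2\cup\mathfrak P_3$ with $\mathfrak P_\infty=\{(1,0,0,0),(0,1,0,0),(0,0,1,0),(0,0,0,1)\}$; $\mathfrak P_0=\{(1,1,1,1),(1,1,-1,-1),(1,-1,1,-1),(1,-1,-1,1)\}$; $\mathfrak P_1=\{(bc,-\mathbf i,-\mathbf ib,-c),(bc,-\mathbf i,\mathbf ib,c),(bc,\mathbf i,-\mathbf ib,c),(bc,\mathbf i,\mathbf ib,-c)\}$; $\mathfrak P_2=\{(ac,-a,-\mathbf i,-\mathbf ic),(ac,-a,\mathbf i,\mathbf ic),(ac,a,-\mathbf i,\mathbf ic),(ac,a,\mathbf i,-\mathbf ic)\}$; $\mathfrak P_3=\{(ab,-\mathbf ia,-b,-\mathbf i),(ab,-\mathbf ia,b,\mathbf i),(ab,\mathbf ia,-b,\mathbf i),(ab,\mathbf ia,b,-\mathbf i)\}$. *)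

theory Defs
  imports
    "HOL-Analysis.Analysis"
    "HOL-Library.Poly_Mapping"
    "HOL-Algebra.Algebraic_Closure_Type"
begin

text \<open>Words under concatenation, written additively so that \<open>'g word \<Rightarrow>\<^sub>0 'k\<close>, with the
  convolution product of the library, is the free associative algebra \<open>k\<langle>'g\<rangle>\<close>.\<close>

datatype 'g word = Word (letters: "'g list")

instantiation word :: (type) monoid_add
begin

definition zero_word :: "'a word" where "0 = Word []"

definition plus_word :: "'a word \<Rightarrow> 'a word \<Rightarrow> 'a word" where
  "u + v = Word (letters u @ letters v)"

instance by standard (auto simp: zero_word_def plus_word_def)

end

text \<open>The numeral type \<open>4\<close> is \<open>{0,1,2,3}\<close> (with \<open>4 = 0\<close>), so it indexes \<open>y\<^sub>0,\<dots>,y\<^sub>3\<close>.\<close>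

type_synonym 'k free_alg = "4 word \<Rightarrow>\<^sub>0 'k"

definition ygen :: "4 \<Rightarrow> 'k::field free_alg" where
  "ygen i = Poly_Mapping.single (Word [i]) 1"

abbreviation scalar :: "'k::field \<Rightarrow> 'k free_alg" where
  "scalar t \<equiv> Poly_Mapping.single 0 t"

definition relations :: "'k::field \<Rightarrow> 'k \<Rightarrow> 'k \<Rightarrow> 'k free_alg set" where
  "relations \<alpha> \<beta> \<gamma> =
     (\<Union>(t, i, j, k) \<in> {(\<alpha>, 1, 2, 3), (\<beta>, 2, 3, 1), (\<gamma>, 3, 1, 2)}.
        {(ygen 0 * ygen i - ygen i * ygen 0) - scalar t * (ygen j * ygen k - ygen k * ygen j),
         (ygen 0 * ygen i + ygen i * ygen 0) - (ygen j * ygen k + ygen k * ygen j)})"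

text \<open>\<^const>\<open>genideal\<close> is the two-sided ideal generated by a set; it is automatically closed under
  scalars, because these lie in the free algebra.\<close>

definition rel_ideal :: "'k::field \<Rightarrow> 'k \<Rightarrow> 'k \<Rightarrow> 'k free_alg set" where
  "rel_ideal \<alpha> \<beta> \<gamma> = genideal ring_of_type_algebra (relations \<alpha> \<beta> \<gamma>)"

definition alg_A :: "'k::field \<Rightarrow> 'k \<Rightarrow> 'k \<Rightarrow> 'k free_alg set ring" where
  "alg_A \<alpha> \<beta> \<gamma> = ring_of_type_algebra Quot rel_ideal \<alpha> \<beta> \<gamma>"

text \<open>The element \<open>\<Sum>\<^sub>i l\<^sub>i y\<^sub>i\<close> of \<open>A\<^sub>1\<close>. From here on \<open>A\<^sub>1\<close> is identified with
  \<open>k\<^sup>4\<close> through these coordinates; this is legitimate by \<open>inj_degree_one\<close> below.\<close>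

definition linear_form :: "'k::field ^ 4 \<Rightarrow> 'k free_alg" where
  "linear_form l = (\<Sum>i\<in>UNIV. scalar (l $ i) * ygen i)"

definition degree_one :: "'k::field \<Rightarrow> 'k \<Rightarrow> 'k \<Rightarrow> 'k ^ 4 \<Rightarrow> 'k free_alg set" where
  "degree_one \<alpha> \<beta> \<gamma> l = rel_ideal \<alpha> \<beta> \<gamma> +>\<^bsub>ring_of_type_algebra\<^esub> linear_form l"

definition commuting_subspace :: "'k::field \<Rightarrow> 'k \<Rightarrow> 'k \<Rightarrow> ('k ^ 4) set \<Rightarrow> bool" where
  "commuting_subspace \<alpha> \<beta> \<gamma> U \<longleftrightarrow>
     (\<exists>l l'. U = vec.span {l, l'} \<and> vec.dim U = 2 \<and>
        degree_one \<alpha> \<beta> \<gamma> l \<otimes>\<^bsub>alg_A \<alpha> \<beta> \<gamma>\<^esub> degree_one \<alpha> \<beta> \<gamma> l' =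
        degree_one \<alpha> \<beta> \<gamma> l' \<otimes>\<^bsub>alg_A \<alpha> \<beta> \<gamma>\<^esub> degree_one \<alpha> \<beta> \<gamma> l)"

lemma ring_of_type_algebra_simps [simp]:
  "carrier ring_of_type_algebra = (UNIV :: 'a::ring_1 set)"
  "f \<otimes>\<^bsub>ring_of_type_algebra\<^esub> g = (f * g :: 'a)"
  "\<one>\<^bsub>ring_of_type_algebra\<^esub> = (1 :: 'a)"
  "\<zero>\<^bsub>ring_of_type_algebra\<^esub> = (0 :: 'a)"
  "f \<oplus>\<^bsub>ring_of_type_algebra\<^esub> g = (f + g :: 'a)"
  by (simp_all add: ring_of_type_algebra_def)

lemma ring_type_algebra: "ring (ring_of_type_algebra :: 'a::ring_1 ring)"
proof -
  have "\<exists>z. x + z = 0" for x :: 'a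
    using add.right_inverse by blast
  then show ?thesis
    unfolding ring_of_type_algebra_def using add.right_inverse
    by unfold_locales (auto simp: algebra_simps Units_def)
qed

lemma plus_word_eq_Nil: "u + v = Word [] \<longleftrightarrow> u = Word [] \<and> v = Word []"
  by (cases u; cases v) (auto simp: plus_word_def)

lemma plus_word_eq_single:
  "u + v = Word [i] \<longleftrightarrow> u = Word [] \<and> v = Word [i] \<or> u = Word [i] \<and> v = Word []"
  by (cases u; cases v) (auto simp: plus_word_def append_eq_Cons_conv)

definition low_degree_free :: "'k::field free_alg set" where
  "low_degree_free = {f. Poly_Mapping.lookup f (Word []) = 0 \<and> (\<forall>i. Poly_Mapping.lookup f (Word [i]) = 0)}"

lemma low_degree_freeI:
  assumes "\<And>w. length (letters w) \<le> 1 \<Longrightarrow> Poly_Mapping.lookup f w = 0"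
  shows "f \<in> low_degree_free"
  using assms by (auto simp: low_degree_free_def)

lemma lookup_low:
  assumes "f \<in> low_degree_free" "length (letters w) \<le> 1"
  shows "Poly_Mapping.lookup f w = 0"
  using assms by (cases w; cases "letters w") (auto simp: low_degree_free_def)

lemma low_degree_free_mult:
  fixes f g :: "'k::field free_alg"
  assumes "f \<in> low_degree_free \<or> g \<in> low_degree_free"
  shows "f * g \<in> low_degree_free"
proof (rule low_degree_freeI)
  fix w :: "4 word"
  assume w: "length (letters w) \<le> 1"
  have *: "Poly_Mapping.lookup f u * Poly_Mapping.lookup g v = 0" if "w = u + v" for u v
  proof -
    have "length (letters u) \<le> 1" "length (letters v) \<le> 1"
      using that w by (auto simp: plus_word_def)
    then show ?thesis
      using assms lookup_low by fastforce
  qed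
  have "Poly_Mapping.lookup (f * g) w =
      (\<Sum>u. Poly_Mapping.lookup f u * (\<Sum>v. Poly_Mapping.lookup g v when w = u + v))"
    by (simp add: lookup_mult)
  also have "(\<lambda>u. Poly_Mapping.lookup f u * (\<Sum>v. Poly_Mapping.lookup g v when w = u + v)) = (\<lambda>u. 0)"
  proof
    fix u
    have "Poly_Mapping.lookup f u * (\<Sum>v. Poly_Mapping.lookup g v when w = u + v) = 0"
    proof (cases "Poly_Mapping.lookup f u = 0")
      case False
      then have "(\<lambda>v. Poly_Mapping.lookup g v when w = u + v) = (\<lambda>v. 0)"
        using * by (auto simp: when_def fun_eq_iff)
      then have "(\<Sum>v. Poly_Mapping.lookup g v when w = u + v) = 0"
        by (simp only: Sum_any.neutral)
      then show ?thesis by simp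
    qed simp
    then show "Poly_Mapping.lookup f u * (\<Sum>v. Poly_Mapping.lookup g v when w = u + v) = 0" .
  qed
  finally show "Poly_Mapping.lookup (f * g) w = 0" by simp
qed

lemma ideal_low_degree_free:
  "ideal (low_degree_free :: 'k::field free_alg set) ring_of_type_algebra"
proof (intro idealI ring_type_algebra)
  interpret R: ring "ring_of_type_algebra :: 'k free_alg ring"
    by (rule ring_type_algebra)
  have inv: "inv\<^bsub>add_monoid ring_of_type_algebra\<^esub> f = - f" for f :: "'k free_alg"
    using R.minus_equality[of "- f" f] by (simp add: a_inv_def)
  show "subgroup (low_degree_free :: 'k free_alg set) (add_monoid ring_of_type_algebra)"
  proof (rule group.subgroupI[OF R.a_group])
    show "inv\<^bsub>add_monoid ring_of_type_algebra\<^esub> f \<in> low_degree_free"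
      if "f \<in> low_degree_free" for f :: "'k free_alg"
      using that unfolding inv by (simp add: low_degree_free_def)
  qed (auto simp: low_degree_free_def lookup_add intro: exI[of _ 0])
qed (use low_degree_free_mult in auto)

lemma ygen_mult_ygen: "ygen i * ygen j = Poly_Mapping.single (Word [i, j]) (1::'k::field)"
  by (simp add: ygen_def mult_single plus_word_def)

lemma relations_low_degree_free: "relations \<alpha> \<beta> \<gamma> \<subseteq> low_degree_free"
proof -
  have m: "ygen i * ygen j \<in> low_degree_free" for i j
    by (simp add: low_degree_free_def ygen_mult_ygen lookup_single)
  have s: "f - g \<in> low_degree_free" "f + g \<in> low_degree_free"
    if "f \<in> low_degree_free" "g \<in> low_degree_free" for f g :: "'a free_alg"
    using that by (auto simp: low_degree_free_def lookup_minus lookup_add)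
  show ?thesis
    unfolding relations_def by (auto intro!: s m low_degree_free_mult)
qed

lemma rel_ideal_low_degree_free: "rel_ideal \<alpha> \<beta> \<gamma> \<subseteq> low_degree_free"
  unfolding rel_ideal_def
  by (intro ring.genideal_minimal ring_type_algebra ideal_low_degree_free
      relations_low_degree_free)

lemma lookup_linear_form: "Poly_Mapping.lookup (linear_form l) (Word [i]) = l $ i"
proof -
  have "Poly_Mapping.lookup (linear_form l) (Word [i]) = (\<Sum>j\<in>UNIV. (l $ j when j = i))"
    by (simp add: linear_form_def lookup_sum ygen_def mult_single lookup_single)
  also have "\<dots> = l $ i"
    by (simp add: when_def)
  finally show ?thesis .
qed

lemma ideal_rel_ideal: "ideal (rel_ideal \<alpha> \<beta> \<gamma>) ring_of_type_algebra"
  unfolding rel_ideal_def by (intro ring.genideal_ideal ring_type_algebra) auto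

lemma inj_degree_one: "inj (degree_one \<alpha> \<beta> \<gamma> :: 'k::field ^ 4 \<Rightarrow> _)"
proof (rule injI)
  fix l l' :: "'k ^ 4"
  interpret R: ideal "rel_ideal \<alpha> \<beta> \<gamma>" "ring_of_type_algebra :: 'k free_alg ring"
    by (rule ideal_rel_ideal)
  assume "degree_one \<alpha> \<beta> \<gamma> l = degree_one \<alpha> \<beta> \<gamma> l'"
  then have "linear_form l \<in> rel_ideal \<alpha> \<beta> \<gamma> +>\<^bsub>ring_of_type_algebra\<^esub> linear_form l'"
    unfolding degree_one_def using R.a_rcos_self[of "linear_form l"] by simp
  then obtain r where r: "r \<in> rel_ideal \<alpha> \<beta> \<gamma>" "linear_form l = r + linear_form l'"
    by (auto simp: a_r_coset_def r_coset_def)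
  have "r \<in> low_degree_free"
    using r(1) rel_ideal_low_degree_free by blast
  then have "Poly_Mapping.lookup r (Word [i]) = 0" for i
    by (simp add: low_degree_free_def)
  then have "l $ i = l' $ i" for i
    using r(2) by (metis add.left_neutral lookup_add lookup_linear_form)
  then show "l = l'"
    by (simp add: vec_eq_iff)
qed

definition proj_points :: "('k::field ^ 'n) set set" where
  "proj_points = {P. vec.subspace P \<and> vec.dim P = 1}"

definition proj_lines :: "('k::field ^ 'n) set set" where
  "proj_lines = {L. vec.subspace L \<and> vec.dim L = 2}"

definition proj_space :: "('k::field ^ 'n) set \<Rightarrow> ('k ^ 'n) set set" where
  "proj_space W = {P \<in> proj_points. P \<subseteq> W}"

text \<open>For \<open>f\<close> homogeneous.\<close>

definition hypersurface :: "('k::field ^ 'n \<Rightarrow> 'k) \<Rightarrow> ('k ^ 'n) set set" where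
  "hypersurface f = {P \<in> proj_points. \<forall>v\<in>P. f v = 0}"

text \<open>Points of \<open>\<bbbP>(A\<^sub>1\<^sup>*)\<close> are given by their coordinates \<open>(y\<^sub>0,\<dots>,y\<^sub>3)\<close>, that is, with
  respect to the basis dual to the \<open>y\<^sub>i\<close>.\<close>

definition zero_locus :: "('k::field ^ 4) set \<Rightarrow> ('k ^ 4) set" where
  "zero_locus U = {p. \<forall>l\<in>U. (\<Sum>i\<in>UNIV. l $ i * p $ i) = 0}"

datatype pl_index = Z01 | Z02 | Z03 | Z12 | Z13 | Z23

lemma UNIV_pl_index: "UNIV = {Z01, Z02, Z03, Z12, Z13, Z23}"
  using pl_index.exhaust by auto

instance pl_index :: finite
  by standard (simp add: UNIV_pl_index)

lemma CARD_pl_index: "CARD(pl_index) = 6"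
  by (simp add: UNIV_pl_index)

primrec pl_pair :: "pl_index \<Rightarrow> 4 \<times> 4" where
  "pl_pair Z01 = (0, 1)"
| "pl_pair Z02 = (0, 2)"
| "pl_pair Z03 = (0, 3)"
| "pl_pair Z12 = (1, 2)"
| "pl_pair Z13 = (1, 3)"
| "pl_pair Z23 = (2, 3)"

definition pl_coords :: "'k::field ^ 4 \<Rightarrow> 'k ^ 4 \<Rightarrow> 'k ^ pl_index" where
  "pl_coords l l' = (\<chi> z. case pl_pair z of (r, s) \<Rightarrow> l $ r * l' $ s - l' $ r * l $ s)"

text \<open>The point of \<open>\<bbbP>\<^sup>5\<close> of a line: all pairs of equations of the line have proportional
  coordinate vectors, and their span is the point.\<close>

definition pluecker :: "('k::field ^ 4) set \<Rightarrow> ('k ^ pl_index) set" where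
  "pluecker L = vec.span {pl_coords l l' | l l'. zero_locus {l, l'} = L}"

definition grassmannian :: "('k::field ^ pl_index) set set" where
  "grassmannian = pluecker ` proj_lines"

text \<open>A smooth conic in the plane \<open>\<bbbP>(W)\<close>: \<open>T\<close> is a choice of homogeneous coordinates on the
  plane and \<open>M\<close> the Gram matrix of the equation (the characteristic is not 2).\<close>

definition conic_in_plane :: "('k::field ^ 'n) set \<Rightarrow> ('k ^ 'n) set set \<Rightarrow> bool" where
  "conic_in_plane W C \<longleftrightarrow>
     vec.subspace W \<and> vec.dim W = 3 \<and>
     (\<exists>(T :: 'k ^ 3 ^ 'n) (M :: 'k ^ 3 ^ 3).
        inj ((*v) T) \<and> range ((*v) T) = W \<and> transpose M = M \<and> invertible M \<and>
        C = {vec.span {T *v u} | u. u \<noteq> 0 \<and> (\<Sum>i\<in>UNIV. u $ i * (M *v u) $ i) = 0})"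

definition ruling :: "('k::field ^ 4) set set \<Rightarrow> ('k ^ 4) set set \<Rightarrow> bool" where
  "ruling R Q \<longleftrightarrow>
     R \<subseteq> proj_lines \<and> (\<forall>L\<in>R. proj_space L \<subseteq> Q) \<and> (\<forall>P\<in>Q. \<exists>!L. L \<in> R \<and> P \<subseteq> L)"

definition vec4 :: "'k \<Rightarrow> 'k \<Rightarrow> 'k \<Rightarrow> 'k \<Rightarrow> 'k ^ 4" where
  "vec4 t0 t1 t2 t3 = (\<chi> i. if i = 0 then t0 else if i = 1 then t1 else if i = 2 then t2 else t3)"

definition linear_ext :: "'k::field ^ 4 \<Rightarrow> 'k ^ 4 \<Rightarrow> 'k ^ 4 \<Rightarrow> 'k ^ 4 \<Rightarrow> 'k ^ 4 \<Rightarrow> 'k ^ 4" where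
  "linear_ext v0 v1 v2 v3 l = l $ 0 *s v0 + l $ 1 *s v1 + l $ 2 *s v2 + l $ 3 *s v3"

text \<open>In \<open>psi\<close>, \<open>lines_C\<close> and \<open>torsion_pts\<close> the argument of type \<open>4\<close> is the subscript
  \<open>j \<in> {0,1,2,3}\<close>; \<open>psi\<close> is the identity for \<open>j = 0\<close>.\<close>

definition psi :: "'k::field \<Rightarrow> 'k \<Rightarrow> 'k \<Rightarrow> 'k \<Rightarrow> 4 \<Rightarrow> 'k ^ 4 \<Rightarrow> 'k ^ 4" where
  "psi a b c ii j =
     (let e = (\<lambda>i. axis i 1) in
      if j = 0 then id
      else if j = 1 then
        linear_ext ((ii * b * c) *s e 1) (- e 0) (- (b *s e 3)) (- ((ii * c) *s e 2))
      else if j = 2 then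
        linear_ext ((ii * a * c) *s e 2) ((ii * a) *s e 3) (- e 0) (c *s e 1)
      else
        linear_ext ((a * b) *s e 3) (- ((ii * a) *s e 2)) (- (b *s e 1)) (- (ii *s e 0)))"

definition lines_C ::
  "'k::field \<Rightarrow> 'k \<Rightarrow> 'k \<Rightarrow> 'k \<Rightarrow> 'k \<Rightarrow> 'k \<Rightarrow> 'k \<Rightarrow> 4 \<Rightarrow> ('k ^ 4) set set" where
  "lines_C \<alpha> \<beta> \<gamma> a b c ii j =
     {zero_locus (psi a b c ii j ` U) | U. commuting_subspace \<alpha> \<beta> \<gamma> U}"

definition proj_pt :: "'k::field \<Rightarrow> 'k \<Rightarrow> 'k \<Rightarrow> 'k \<Rightarrow> ('k ^ 4) set" where
  "proj_pt t0 t1 t2 t3 = vec.span {vec4 t0 t1 t2 t3}"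

definition pts_infty :: "('k::field ^ 4) set set" where
  "pts_infty = {proj_pt 1 0 0 0, proj_pt 0 1 0 0, proj_pt 0 0 1 0, proj_pt 0 0 0 1}"

definition torsion_pts :: "'k::field \<Rightarrow> 'k \<Rightarrow> 'k \<Rightarrow> 'k \<Rightarrow> 4 \<Rightarrow> ('k ^ 4) set set" where
  "torsion_pts a b c ii j =
     (if j = 0 then
        {proj_pt 1 1 1 1, proj_pt 1 1 (-1) (-1), proj_pt 1 (-1) 1 (-1), proj_pt 1 (-1) (-1) 1}
      else if j = 1 then
        {proj_pt (b * c) (- ii) (- (ii * b)) (- c), proj_pt (b * c) (- ii) (ii * b) c,
         proj_pt (b * c) ii (- (ii * b)) c, proj_pt (b * c) ii (ii * b) (- c)}
      else if j = 2 then
        {proj_pt (a * c) (- a) (- ii) (- (ii * c)), proj_pt (a * c) (- a) ii (ii * c),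
         proj_pt (a * c) a (- ii) (ii * c), proj_pt (a * c) a ii (- (ii * c))}
      else
        {proj_pt (a * b) (- (ii * a)) (- b) (- ii), proj_pt (a * b) (- (ii * a)) b ii,
         proj_pt (a * b) (ii * a) (- b) ii, proj_pt (a * b) (ii * a) b (- ii)})"

definition pts_P :: "'k::field \<Rightarrow> 'k \<Rightarrow> 'k \<Rightarrow> 'k \<Rightarrow> ('k ^ 4) set set" where
  "pts_P a b c ii = pts_infty \<union> (\<Union>j. torsion_pts a b c ii j)"

end

theory Submission
  imports Defs
begin

text \<open>
  For scalars \<open>p, q, r\<close> let \<open>\<bbbP>(plane p q r)\<close> be the plane \<open>z\<^sub>2\<^sub>3 = p z\<^sub>0\<^sub>1\<close>, \<open>z\<^sub>1\<^sub>3 = q z\<^sub>0\<^sub>2\<close>,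
  \<open>z\<^sub>1\<^sub>2 = r z\<^sub>0\<^sub>3\<close> of \<open>\<bbbP>\<^sup>5\<close>. All four families turn out to consist of exactly the lines whose
  Pluecker point lies in such a plane, with nonzero coefficients \<open>plane_coeffs \<alpha> \<beta> \<gamma> j\<close>; so
  everything about conics and rulings is proved once, for arbitrary \<open>p, q, r \<noteq> 0\<close>.

  \<^item> On the plane the Pluecker relation becomes the diagonal form \<open>p x\<^sup>2 - q y\<^sup>2 + r w\<^sup>2\<close> in
    \<open>x = z\<^sub>0\<^sub>1\<close>, \<open>y = z\<^sub>0\<^sub>2\<close>, \<open>w = z\<^sub>0\<^sub>3\<close>, hence a smooth conic (\<open>conic_in_plane_lines_in_plane\<close>).
  \<^item> A point \<open>v\<close> lies on the line with Pluecker vector \<open>z\<close> iff the contraction of the two-form \<open>z\<close>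
    with \<open>v\<close> vanishes. For \<open>z\<close> in the plane these are four linear equations in \<open>(x, y, w)\<close>, whose
    \<open>3 \<times> 3\<close> minors are, up to sign, the coordinates of \<open>v\<close> times the value at \<open>v\<close> of
    \<open>v\<^sub>0\<^sup>2 - q r v\<^sub>1\<^sup>2 + p r v\<^sub>2\<^sup>2 - p q v\<^sub>3\<^sup>2\<close>. So there is a nonzero solution exactly on this quadric. It is
    unique up to scaling because the \<open>2 \<times> 2\<close> minors do not all vanish, and it is decomposable because
    a two-form on a four-dimensional space with a nonzero kernel vector has Pfaffian zero. Hence the
    lines form a ruling (\<open>ruling_lines_in_plane\<close>).
  \<^item> The commutator of two linear forms is skew, and \<open>[y\<^sub>2,y\<^sub>3]\<close>, \<open>[y\<^sub>3,y\<^sub>1]\<close>, \<open>[y\<^sub>1,y\<^sub>2]\<close> are linearly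
    independent in \<open>A\<^sub>2\<close>, while \<open>[y\<^sub>0,y\<^sub>i] = \<alpha>\<^sub>i [y\<^sub>j,y\<^sub>k]\<close>. So two forms commute iff three linear
    equations in their Pluecker coordinates hold, namely those of \<open>plane (-\<alpha>) \<beta> (-\<gamma>)\<close>
    (\<open>commutator_in_rel_ideal_iff\<close>). The independence is obtained from three linear functionals on
    words of length two that vanish on the ideal of relations.
  \<^item> Each \<open>\<psi>\<^sub>j\<close> permutes the basis up to scalars, hence so does its second exterior power, and it
    carries that plane to the one with coefficients \<open>plane_coeffs \<alpha> \<beta> \<gamma> j\<close>
    (\<open>pl_coords_psi_in_plane_iff\<close>).
  \<^item> The quadrics are diagonal, so membership of the points of \<open>\<PP>\<^sub>i\<close> depends only on the squares of
    their coordinates, which are the same for all four points of \<open>\<PP>\<^sub>i\<close>. Given that they lie on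
    \<open>Q\<^sub>j\<close>, the unique line through each of them is part of the ruling.
\<close>

(* Power series use the same infix for their coefficients as vectors for their components. *)
no_notation fps_nth (infixl "$" 75)

section \<open>Lines in projective three-space and their Pluecker coordinates\<close>

text \<open>The library enumerates the four indices as \<open>1, 2, 3, 4\<close>; here they are \<open>0, 1, 2, 3\<close>.\<close>

lemma UNIV_4_from_0: "(UNIV :: 4 set) = {0, 1, 2, 3}"
  unfolding UNIV_4 by auto

lemma four_eq_zero: "(4::4) = 0"
  by simp

lemma forall_4_from_0: "(\<forall>i::4. P i) \<longleftrightarrow> P 0 \<and> P 1 \<and> P 2 \<and> P 3"
  unfolding ball_UNIV[symmetric] UNIV_4_from_0 by simp

lemma sum_4_from_0: "(\<Sum>i\<in>UNIV. f i) = f (0::4) + f 1 + f 2 + f 3"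
  unfolding sum_4 four_eq_zero by (simp only: add_ac)

lemma vec4_nth [simp]:
  "vec4 s t u w $ 0 = s" "vec4 s t u w $ 1 = t" "vec4 s t u w $ 2 = u" "vec4 s t u w $ 3 = w"
  by (simp_all add: vec4_def)

definition pairing :: "'k::field ^ 4 \<Rightarrow> 'k ^ 4 \<Rightarrow> 'k" where
  "pairing l v = (\<Sum>i\<in>UNIV. l $ i * v $ i)"

definition minor :: "'k::field ^ 4 \<Rightarrow> 'k ^ 4 \<Rightarrow> 4 \<Rightarrow> 4 \<Rightarrow> 'k" where
  "minor l l' r s = l $ r * l' $ s - l' $ r * l $ s"

lemma pairing_commute: "pairing l v = pairing v l"
  by (simp add: pairing_def mult.commute)

lemma pairing_lin_left [simp]:
  "pairing 0 v = 0" "pairing (l + m) v = pairing l v + pairing m v"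
  "pairing (t *s l) v = t * pairing l v"
  by (simp_all add: pairing_def algebra_simps sum.distrib sum_distrib_left)

lemma pairing_lin_right [simp]:
  "pairing v 0 = 0" "pairing v (l + m) = pairing v l + pairing v m"
  "pairing v (t *s l) = t * pairing v l"
  using pairing_lin_left pairing_commute by metis+

lemma pairing_axis [simp]: "pairing l (axis i t) = l $ i * t"
proof -
  have "pairing l (axis i t) = (\<Sum>j\<in>UNIV. if j = i then l $ j * t else 0)"
    unfolding pairing_def by (rule sum.cong) (auto simp: axis_def)
  then show ?thesis by simp
qed

lemma zero_locus_pairing: "zero_locus U = {v. \<forall>l\<in>U. pairing l v = 0}"
  by (simp add: zero_locus_def pairing_def)

lemma mem_zero_locus_pair:
  "v \<in> zero_locus {l, l'} \<longleftrightarrow> pairing l v = 0 \<and> pairing l' v = 0"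
  by (simp add: zero_locus_pairing)

lemma subspace_zero_locus: "vec.subspace (zero_locus U)"
  by (auto simp: vec.subspace_def zero_locus_pairing)

lemma zero_locus_span: "zero_locus (vec.span S) = zero_locus S"
proof
  show "zero_locus (vec.span S) \<subseteq> zero_locus S"
    using vec.span_superset[of S] by (auto simp: zero_locus_pairing)
  show "zero_locus S \<subseteq> zero_locus (vec.span S)"
  proof
    fix v assume v: "v \<in> zero_locus S"
    have "S \<subseteq> zero_locus {v}"
      using v by (auto simp: zero_locus_pairing pairing_commute)
    then have "vec.span S \<subseteq> zero_locus {v}"
      by (rule vec.span_minimal[OF _ subspace_zero_locus])
    then show "v \<in> zero_locus (vec.span S)"
      by (auto simp: zero_locus_pairing pairing_commute)
  qed
qed

lemma span_pair: "vec.span {l, l'} = {s *s l + t *s l' | s t. True}"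
proof -
  have "x - s *s l = t *s l' \<longleftrightarrow> x = s *s l + t *s l'" for x s t
    by (metis add_diff_cancel_left' diff_add_cancel add.commute)
  then show ?thesis
    by (simp add: vec.span_insert vec.span_singleton image_iff)
qed

lemma pl_coords_nth:
  "pl_coords l l' $ Z01 = minor l l' 0 1" "pl_coords l l' $ Z02 = minor l l' 0 2"
  "pl_coords l l' $ Z03 = minor l l' 0 3" "pl_coords l l' $ Z12 = minor l l' 1 2"
  "pl_coords l l' $ Z13 = minor l l' 1 3" "pl_coords l l' $ Z23 = minor l l' 2 3"
  by (simp_all add: pl_coords_def minor_def)

lemma pl_vec_eq_iff:
  "z = w \<longleftrightarrow> z $ Z01 = w $ Z01 \<and> z $ Z02 = w $ Z02 \<and> z $ Z03 = w $ Z03 \<and>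
     z $ Z12 = w $ Z12 \<and> z $ Z13 = w $ Z13 \<and> z $ Z23 = w $ Z23"
  unfolding vec_eq_iff ball_UNIV[symmetric] UNIV_pl_index by simp

lemma minor_swap: "minor l l' s r = - minor l l' r s"
  by (simp add: minor_def)

lemma pl_coords_eq_0_iff: "pl_coords l l' = 0 \<longleftrightarrow> (\<forall>r s. minor l l' r s = 0)"
proof
  assume "pl_coords l l' = 0"
  then show "\<forall>r s. minor l l' r s = 0"
    by (simp add: pl_vec_eq_iff pl_coords_nth forall_4_from_0 minor_def mult.commute)
qed (simp add: pl_vec_eq_iff pl_coords_nth)

lemma pl_coords_nonzeroE:
  assumes "pl_coords l l' \<noteq> 0"
  obtains r s where "minor l l' r s \<noteq> 0"
  using assms pl_coords_eq_0_iff by blast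

lemma pl_coords_change_of_basis:
  "pl_coords (s *s l + t *s l') (s' *s l + t' *s l') = (s * t' - t * s') *s pl_coords l l'"
  by (simp add: pl_vec_eq_iff pl_coords_nth minor_def algebra_simps)

lemma dim_pair_eq_2_iff: "vec.dim {l, l'} = 2 \<longleftrightarrow> pl_coords l l' \<noteq> 0"
proof -
  have "vec.dim {l, l'} = 2 \<longleftrightarrow> l \<notin> vec.span {l'} \<and> l' \<noteq> 0"
    by (simp add: vec.dim_insert)
  also have "\<dots> \<longleftrightarrow> pl_coords l l' \<noteq> 0"
  proof (cases "l' = 0")
    case True
    then show ?thesis by (simp add: pl_coords_eq_0_iff minor_def)
  next
    case False
    then obtain s where s: "l' $ s \<noteq> 0" by (auto simp: vec_eq_iff)
    have "l = (l $ s / l' $ s) *s l'" if "pl_coords l l' = 0"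
      using that s unfolding pl_coords_eq_0_iff
      by (simp add: minor_def vec_eq_iff field_simps)
    moreover have "pl_coords (t *s l') l' = 0" for t
      by (simp add: pl_coords_eq_0_iff minor_def)
    ultimately have "l \<in> vec.span {l'} \<longleftrightarrow> pl_coords l l' = 0"
      unfolding vec.span_singleton by blast
    then show ?thesis
      using False by simp
  qed
  finally show ?thesis .
qed

text \<open>By the three-term identity a vector orthogonal to both \<open>l\<close> and \<open>l'\<close>, supported on any three
  chosen indices. These vectors span the line \<open>l = l' = 0\<close>, and they test membership in the span
  of \<open>l\<close> and \<open>l'\<close>. For \<open>t = r\<close> or \<open>t = s\<close> the formula gives zero, which lets
  Cramer's rule below treat all indices \<open>t\<close> alike.\<close>

definition circuit :: "'k::field ^ 4 \<Rightarrow> 'k ^ 4 \<Rightarrow> 4 \<Rightarrow> 4 \<Rightarrow> 4 \<Rightarrow> 'k ^ 4" where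
  "circuit l l' r s t =
     axis t (minor l l' r s) + axis r (minor l l' s t) + axis s (minor l l' t r)"

lemma circuit_in_zero_locus: "circuit l l' r s t \<in> zero_locus {l, l'}"
  by (simp add: mem_zero_locus_pair circuit_def minor_def algebra_simps)

text \<open>Double annihilators by Cramer's rule: if the minor of \<open>l, l'\<close> at \<open>r, s\<close> is nonzero, then a
  form \<open>m\<close> that vanishes on the circuits through \<open>r\<close> and \<open>s\<close> is the combination of \<open>l\<close> and \<open>l'\<close>
  that agrees with it at \<open>r\<close> and \<open>s\<close>.\<close>

lemma span_eq_annihilator:
  assumes "pl_coords l l' \<noteq> 0"
  shows "zero_locus (zero_locus {l, l'}) = vec.span {l, l'}"
proof
  obtain r s where d: "minor l l' r s \<noteq> 0"
    using assms by (rule pl_coords_nonzeroE)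
  show "zero_locus (zero_locus {l, l'}) \<subseteq> vec.span {l, l'}"
  proof
    fix m assume m: "m \<in> zero_locus (zero_locus {l, l'})"
    let ?d = "minor l l' r s"
    have "?d * m $ t = minor m l' r s * l $ t + minor l m r s * l' $ t" for t
    proof -
      have "pairing m (circuit l l' r s t) = 0"
        using m circuit_in_zero_locus[of l l' r s t] by (simp add: zero_locus_pairing pairing_commute[of m])
      then show ?thesis
        by (simp add: circuit_def minor_def algebra_simps)
    qed
    then have "m = (minor m l' r s / ?d) *s l + (minor l m r s / ?d) *s l'"
      using d by (simp add: vec_eq_iff divide_simps) (simp add: mult.commute)
    then show "m \<in> vec.span {l, l'}"
      unfolding span_pair by blast
  qed
  show "vec.span {l, l'} \<subseteq> zero_locus (zero_locus {l, l'})"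
    by (rule vec.span_minimal[OF _ subspace_zero_locus])
      (auto simp: zero_locus_pairing pairing_commute)
qed

lemma complementary_indices:
  fixes r s :: 4
  assumes "r \<noteq> s"
  obtains t t' where "UNIV = {r, s, t, t'}" "t \<noteq> r" "t \<noteq> s" "t' \<noteq> r" "t' \<noteq> s" "t \<noteq> t'"
proof -
  have "card (UNIV - {r, s}) = 2"
    using assms by (subst card_Diff_subset) auto
  then obtain t t' where "UNIV - {r, s} = {t, t'}" "t \<noteq> t'"
    by (auto simp: card_2_iff)
  then show ?thesis
    by (intro that[of t t']) blast+
qed

text \<open>A point of the line is determined by its coordinates outside \<open>r, s\<close>, and each of the two
  circuits has exactly one nonzero coordinate there.\<close>

lemma zero_locus_eq_span_circuits:
  assumes d: "minor l l' r s \<noteq> 0"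
    and idx: "UNIV = {r, s, t, t'}" "t \<noteq> r" "t \<noteq> s" "t' \<noteq> r" "t' \<noteq> s" "t \<noteq> t'"
  shows "zero_locus {l, l'} = vec.span {circuit l l' r s t, circuit l l' r s t'}"
proof
  let ?d = "minor l l' r s"
  have rs: "r \<noteq> s" using d by (auto simp: minor_def)
  show "zero_locus {l, l'} \<subseteq> vec.span {circuit l l' r s t, circuit l l' r s t'}"
  proof
    fix v assume v: "v \<in> zero_locus {l, l'}"
    have sum: "(\<Sum>i\<in>UNIV. f i) = f r + f s + f t + f t'" for f :: "4 \<Rightarrow> 'a"
      unfolding idx(1) using idx(2-) rs by (simp add: add.assoc)
    have "?d * v $ r = v $ t * minor l l' s t + v $ t' * minor l l' s t'"
      "?d * v $ s = v $ t * minor l l' t r + v $ t' * minor l l' t' r"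
    proof -
      have "?d * v $ r - (v $ t * minor l l' s t + v $ t' * minor l l' s t')
          = l' $ s * pairing l v - l $ s * pairing l' v"
        "?d * v $ s - (v $ t * minor l l' t r + v $ t' * minor l l' t' r)
          = l $ r * pairing l' v - l' $ r * pairing l v"
        by (simp_all add: pairing_def sum minor_def algebra_simps)
      then show "?d * v $ r = v $ t * minor l l' s t + v $ t' * minor l l' s t'"
        "?d * v $ s = v $ t * minor l l' t r + v $ t' * minor l l' t' r"
        using v by (simp_all add: mem_zero_locus_pair)
    qed
    moreover have "v = (v $ t / ?d) *s circuit l l' r s t + (v $ t' / ?d) *s circuit l l' r s t'
      \<longleftrightarrow> (\<forall>i\<in>{r, s, t, t'}. v $ i = 
        ((v $ t / ?d) *s circuit l l' r s t + (v $ t' / ?d) *s circuit l l' r s t') $ i)"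
      unfolding vec_eq_iff ball_UNIV[symmetric] idx(1) ..
    ultimately have "v = (v $ t / ?d) *s circuit l l' r s t + (v $ t' / ?d) *s circuit l l' r s t'"
      using idx(2-) rs d by (simp add: circuit_def axis_def field_simps)
    then show "v \<in> vec.span {circuit l l' r s t, circuit l l' r s t'}"
      unfolding span_pair by blast
  qed
  show "vec.span {circuit l l' r s t, circuit l l' r s t'} \<subseteq> zero_locus {l, l'}"
    by (rule vec.span_minimal[OF _ subspace_zero_locus]) (auto simp: circuit_in_zero_locus)
qed

lemma zero_locus_pair_is_span_pair:
  assumes "pl_coords l l' \<noteq> 0"
  obtains v v' where "zero_locus {l, l'} = vec.span {v, v'}" "pl_coords v v' \<noteq> 0"
proof -
  obtain r s where d: "minor l l' r s \<noteq> 0"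
    using assms by (rule pl_coords_nonzeroE)
  then have "r \<noteq> s" by (auto simp: minor_def)
  then obtain t t' where idx: "UNIV = {r, s, t, t'}"
    "t \<noteq> r" "t \<noteq> s" "t' \<noteq> r" "t' \<noteq> s" "t \<noteq> t'"
    by (rule complementary_indices)
  have "minor (circuit l l' r s t) (circuit l l' r s t') t t' = (minor l l' r s)\<^sup>2"
  proof -
    have "circuit l l' r s t $ t = minor l l' r s" "circuit l l' r s t $ t' = 0"
      "circuit l l' r s t' $ t' = minor l l' r s" "circuit l l' r s t' $ t = 0"
      using idx(2-) by (simp_all add: circuit_def axis_def)
    then show ?thesis
      by (simp add: minor_def[of "circuit l l' r s t"] power2_eq_square)
  qed
  then have "pl_coords (circuit l l' r s t) (circuit l l' r s t') \<noteq> 0"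
    using d by (metis pl_coords_eq_0_iff power_eq_0_iff)
  then show ?thesis
    using that zero_locus_eq_span_circuits[OF d idx] by blast
qed

text \<open>Every line has a pair of equations: the annihilator of a basis is again spanned by two vectors,
  and the annihilator of these gives back the line.\<close>

lemma proj_lines_iff_zero_locus:
  "L \<in> proj_lines \<longleftrightarrow> (\<exists>l l'. pl_coords l l' \<noteq> 0 \<and> L = zero_locus {l, l'})"
proof
  assume "\<exists>l l'. pl_coords l l' \<noteq> 0 \<and> L = zero_locus {l, l'}"
  then obtain l l' where l: "pl_coords l l' \<noteq> 0" "L = zero_locus {l, l'}" by blast
  then obtain v v' where v: "L = vec.span {v, v'}" "pl_coords v v' \<noteq> 0"
    using zero_locus_pair_is_span_pair by metis
  then show "L \<in> proj_lines"
    by (simp add: proj_lines_def dim_pair_eq_2_iff)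
next
  assume "L \<in> proj_lines"
  then have L: "vec.subspace L" "vec.dim L = 2" by (auto simp: proj_lines_def)
  then obtain B where B: "vec.span B = L" "card B = 2"
    using vec.basis_subspace_exists by metis
  then obtain v v' where v: "L = vec.span {v, v'}" by (auto simp: card_2_iff)
  then have nz: "pl_coords v v' \<noteq> 0"
    using L by (simp add: dim_pair_eq_2_iff)
  then obtain l l' where l: "zero_locus {v, v'} = vec.span {l, l'}" "pl_coords l l' \<noteq> 0"
    by (rule zero_locus_pair_is_span_pair)
  have "L = zero_locus {l, l'}"
    using span_eq_annihilator[OF nz] l(1) v zero_locus_span by metis
  then show "\<exists>l l'. pl_coords l l' \<noteq> 0 \<and> L = zero_locus {l, l'}"
    using l(2) by blast
qed

text \<open>Any other pair of equations of the line is a change of basis of \<open>l, l'\<close>, which multiplies the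
  Pluecker vector by a determinant.\<close>

lemma pluecker_zero_locus:
  assumes "pl_coords l l' \<noteq> 0"
  shows "pluecker (zero_locus {l, l'}) = vec.span {pl_coords l l'}"
proof
  have "pl_coords m m' \<in> vec.span {pl_coords l l'}"
    if eq: "zero_locus {m, m'} = zero_locus {l, l'}" for m m'
  proof -
    have "{m, m'} \<subseteq> zero_locus (zero_locus {m, m'})"
      by (auto simp: zero_locus_pairing pairing_commute)
    then have "{m, m'} \<subseteq> vec.span {l, l'}"
      using span_eq_annihilator[OF assms] eq by simp
    then obtain s t s' t' where "m = s *s l + t *s l'" "m' = s' *s l + t' *s l'"
      by (auto simp: span_pair)
    then show ?thesis
      unfolding vec.span_singleton using pl_coords_change_of_basis by (metis rangeI)
  qed
  then have "{pl_coords m m' | m m'. zero_locus {m, m'} = zero_locus {l, l'}}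
      \<subseteq> vec.span {pl_coords l l'}"
    by blast
  then show "pluecker (zero_locus {l, l'}) \<subseteq> vec.span {pl_coords l l'}"
    unfolding pluecker_def by (rule vec.span_minimal[OF _ vec.subspace_span])
  have "pl_coords l l' \<in> {pl_coords m m' | m m'. zero_locus {m, m'} = zero_locus {l, l'}}"
    by blast
  then show "vec.span {pl_coords l l'} \<subseteq> pluecker (zero_locus {l, l'})"
    unfolding pluecker_def by (intro vec.span_mono) simp
qed

section \<open>Incidence and decomposability\<close>

text \<open>The interior product with \<open>v\<close> of the two-form \<open>\<Sum> z\<^sub>r\<^sub>s y\<^sub>r \<and> y\<^sub>s\<close>, that is, the skew matrix of
  \<open>z\<close> applied to \<open>v\<close>.\<close>

definition contraction :: "'k::field ^ pl_index \<Rightarrow> 'k ^ 4 \<Rightarrow> 'k ^ 4" where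
  "contraction z v = vec4
     (z $ Z01 * v $ 1 + z $ Z02 * v $ 2 + z $ Z03 * v $ 3)
     (z $ Z12 * v $ 2 + z $ Z13 * v $ 3 - z $ Z01 * v $ 0)
     (z $ Z23 * v $ 3 - z $ Z02 * v $ 0 - z $ Z12 * v $ 1)
     (- z $ Z03 * v $ 0 - z $ Z13 * v $ 1 - z $ Z23 * v $ 2)"

lemma vec_4_eq_iff:
  "v = w \<longleftrightarrow> v $ 0 = w $ 0 \<and> v $ 1 = w $ 1 \<and> v $ 2 = w $ 2 \<and> v $ 3 = w $ (3::4)"
  by (simp add: vec_eq_iff forall_4_from_0)

lemma contraction_pl_coords:
  "contraction (pl_coords l l') v = pairing l' v *s l - pairing l v *s l'"
  by (simp add: vec_4_eq_iff contraction_def pl_coords_nth minor_def pairing_def sum_4_from_0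
      algebra_simps)

text \<open>The contraction of \<open>l \<and> l'\<close> with \<open>v\<close> is \<open>l'(v) l - l(v) l'\<close>, which vanishes only if both
  coefficients do, as \<open>l\<close> and \<open>l'\<close> are independent. So the line can be read off from its Pluecker
  vector.\<close>

lemma zero_locus_eq_contraction_kernel:
  assumes "pl_coords l l' \<noteq> 0"
  shows "zero_locus {l, l'} = {v. contraction (pl_coords l l') v = 0}"
proof (rule Set.set_eqI)
  fix v
  obtain r s where d: "minor l l' r s \<noteq> 0"
    using assms by (rule pl_coords_nonzeroE)
  have "pairing l v = 0 \<and> pairing l' v = 0" if "pairing l' v *s l - pairing l v *s l' = 0"
  proof -
    have e: "pairing l' v * l $ i = pairing l v * l' $ i" for i
      using that by (simp add: vec_eq_iff)
    have "pairing l v * minor l l' r s = pairing l v * l' $ s * l $ r - pairing l v * l' $ r * l $ s"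
      by (simp add: minor_def algebra_simps)
    also have "\<dots> = pairing l' v * l $ s * l $ r - pairing l' v * l $ r * l $ s"
      by (simp only: e)
    also have "\<dots> = 0" by simp
    finally have "pairing l v = 0"
      using d by simp
    have "pairing l' v * minor l l' r s = pairing l' v * l $ r * l' $ s - pairing l' v * l $ s * l' $ r"
      by (simp add: minor_def algebra_simps)
    also have "\<dots> = pairing l v * l' $ r * l' $ s - pairing l v * l' $ s * l' $ r"
      by (simp only: e)
    also have "\<dots> = 0" by simp
    finally have "pairing l' v = 0"
      using d by simp
    then show ?thesis
      using \<open>pairing l v = 0\<close> by simp
  qed
  then show "v \<in> zero_locus {l, l'} \<longleftrightarrow> v \<in> {v. contraction (pl_coords l l') v = 0}"
    by (auto simp: mem_zero_locus_pair contraction_pl_coords)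
qed

definition pfaffian :: "'k::field ^ pl_index \<Rightarrow> 'k" where
  "pfaffian z = z $ Z01 * z $ Z23 - z $ Z02 * z $ Z13 + z $ Z03 * z $ Z12"

lemma pfaffian_pl_coords [simp]: "pfaffian (pl_coords l l') = 0"
  by (simp add: pfaffian_def pl_coords_nth minor_def algebra_simps)

text \<open>If \<open>z = l \<and> l'\<close>, then the rows of the skew matrix of \<open>z\<close> lie in the span of \<open>l\<close> and \<open>l'\<close>. This
  suggests the witnesses: the rows with indices \<open>r\<close> and \<open>s\<close> have Pluecker vector \<open>z\<^sub>r\<^sub>s z\<close>.\<close>

lemma decomposable_if_pfaffian_eq_0:
  assumes "z \<noteq> 0" "pfaffian z = 0"
  obtains l l' where "pl_coords l l' = z"
proof -
  define r0 where "r0 = vec4 0 (z $ Z01) (z $ Z02) (z $ Z03)"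
  define r1 where "r1 = vec4 (- z $ Z01) 0 (z $ Z12) (z $ Z13)"
  define r2 where "r2 = vec4 (- z $ Z02) (- z $ Z12) 0 (z $ Z23)"
  define r3 where "r3 = vec4 (- z $ Z03) (- z $ Z13) (- z $ Z23) 0"
  have pf: "z $ Z01 * z $ Z23 = z $ Z02 * z $ Z13 - z $ Z03 * z $ Z12"
    using assms(2) by (simp add: pfaffian_def algebra_simps)
  have rows: "pl_coords r0 r1 = z $ Z01 *s z" "pl_coords r0 r2 = z $ Z02 *s z"
    "pl_coords r0 r3 = z $ Z03 *s z" "pl_coords r1 r2 = z $ Z12 *s z"
    "pl_coords r1 r3 = z $ Z13 *s z" "pl_coords r2 r3 = z $ Z23 *s z"
    using pf by (simp_all add: pl_vec_eq_iff pl_coords_nth minor_def r0_def r1_def r2_def r3_def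
        algebra_simps)
  have scale: "\<exists>l l'. pl_coords l l' = z" if "t \<noteq> 0" "pl_coords m m' = t *s z" for t m m'
  proof -
    have "pl_coords ((1 / t) *s m) m' = (1 / t) *s pl_coords m m'"
      using pl_coords_change_of_basis[of "1 / t" m 0 m' 0 1] by simp
    then show ?thesis using that by (intro exI[of _ "(1 / t) *s m"] exI[of _ m']) simp
  qed
  have "\<exists>i. z $ i \<noteq> 0"
    using assms(1) by (auto simp: vec_eq_iff)
  then obtain i where "z $ i \<noteq> 0" by blast
  then have "\<exists>l l'. pl_coords l l' = z"
    by (cases i) (use rows scale in blast)+
  then show ?thesis using that by blast
qed

section \<open>Lines whose Pluecker point lies in a plane\<close>

definition lines_in :: "('k::field ^ pl_index) set \<Rightarrow> ('k ^ 4) set set" where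
  "lines_in W = {zero_locus {l, l'} | l l'. pl_coords l l' \<noteq> 0 \<and> pl_coords l l' \<in> W}"

lemma pluecker_lines_in:
  assumes "vec.subspace W"
  shows "pluecker ` lines_in W = grassmannian \<inter> proj_space W"
proof -
  have sub: "vec.span {z} \<subseteq> W \<longleftrightarrow> z \<in> W" for z
    using vec.span_minimal[OF _ assms, of "{z}"] vec.span_base[of z "{z}"] by auto
  show ?thesis
  proof
    show "pluecker ` lines_in W \<subseteq> grassmannian \<inter> proj_space W"
    proof
      fix P assume "P \<in> pluecker ` lines_in W"
      then obtain l l' where l: "pl_coords l l' \<noteq> 0" "pl_coords l l' \<in> W"
        "P = pluecker (zero_locus {l, l'})"
        by (auto simp: lines_in_def)
      then have "P \<in> grassmannian"
        unfolding grassmannian_def by (intro image_eqI) (auto simp: proj_lines_iff_zero_locus)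
      moreover have "P = vec.span {pl_coords l l'}"
        using l by (simp add: pluecker_zero_locus)
      then have "P \<in> proj_space W"
        using l sub by (simp add: proj_space_def proj_points_def)
      ultimately show "P \<in> grassmannian \<inter> proj_space W" by blast
    qed
    show "grassmannian \<inter> proj_space W \<subseteq> pluecker ` lines_in W"
    proof
      fix P assume P: "P \<in> grassmannian \<inter> proj_space W"
      then obtain l l' where l: "pl_coords l l' \<noteq> 0" "P = pluecker (zero_locus {l, l'})"
        by (auto simp: grassmannian_def proj_lines_iff_zero_locus)
      then have "pl_coords l l' \<in> W"
        using P sub by (simp add: pluecker_zero_locus proj_space_def)
      then show "P \<in> pluecker ` lines_in W"
        using l by (auto simp: lines_in_def)
    qed
  qed
qed

lemma pluecker_lines_in_eq:
  "pluecker ` lines_in W = {vec.span {z} | z. z \<noteq> 0 \<and> z \<in> W \<and> pfaffian z = 0}"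
proof
  show "pluecker ` lines_in W \<subseteq> {vec.span {z} | z. z \<noteq> 0 \<and> z \<in> W \<and> pfaffian z = 0}"
  proof
    fix P assume "P \<in> pluecker ` lines_in W"
    then obtain l l' where l: "pl_coords l l' \<noteq> 0" "pl_coords l l' \<in> W"
      "P = vec.span {pl_coords l l'}"
      by (auto simp: lines_in_def pluecker_zero_locus)
    then show "P \<in> {vec.span {z} | z. z \<noteq> 0 \<and> z \<in> W \<and> pfaffian z = 0}"
      by auto
  qed
  show "{vec.span {z} | z. z \<noteq> 0 \<and> z \<in> W \<and> pfaffian z = 0} \<subseteq> pluecker ` lines_in W"
  proof clarify
    fix z :: "'a ^ pl_index" assume z: "z \<noteq> 0" "z \<in> W" "pfaffian z = 0"
    then obtain l l' where "pl_coords l l' = z"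
      by (metis decomposable_if_pfaffian_eq_0)
    then show "vec.span {z} \<in> pluecker ` lines_in W"
      using z by (auto simp: lines_in_def pluecker_zero_locus intro!: image_eqI[of _ _ "zero_locus {l, l'}"])
  qed
qed

definition plane :: "'k::field \<Rightarrow> 'k \<Rightarrow> 'k \<Rightarrow> ('k ^ pl_index) set" where
  "plane p q r = {z. z $ Z23 = p * z $ Z01 \<and> z $ Z13 = q * z $ Z02 \<and> z $ Z12 = r * z $ Z03}"

lemma subspace_plane: "vec.subspace (plane p q r)"
  by (auto simp: vec.subspace_def plane_def algebra_simps)

text \<open>The coordinates \<open>z\<^sub>0\<^sub>1, z\<^sub>0\<^sub>2, z\<^sub>0\<^sub>3\<close> parametrize the plane, and in them the Pfaffian is the
  diagonal form with coefficients \<open>p, -q, r\<close>.\<close>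

lemma conic_in_plane_lines_in_plane:
  fixes p q r :: "'k::field"
  assumes "p \<noteq> 0" "q \<noteq> 0" "r \<noteq> 0"
  shows "conic_in_plane (plane p q r) (pluecker ` lines_in (plane p q r))"
proof -
  define T :: "'k ^ 3 ^ pl_index" where
    "T = (\<chi> z. case z of Z01 \<Rightarrow> axis 1 1 | Z02 \<Rightarrow> axis 2 1 | Z03 \<Rightarrow> axis 3 1
       | Z12 \<Rightarrow> axis 3 r | Z13 \<Rightarrow> axis 2 q | Z23 \<Rightarrow> axis 1 p)"
  define M :: "'k ^ 3 ^ 3" where
    "M = (\<chi> i j. if i = j then if i = 1 then p else if i = 2 then - q else r else 0)"
  have T: "(T *v u) $ Z01 = u $ 1" "(T *v u) $ Z02 = u $ 2" "(T *v u) $ Z03 = u $ 3"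
    "(T *v u) $ Z12 = r * u $ 3" "(T *v u) $ Z13 = q * u $ 2" "(T *v u) $ Z23 = p * u $ 1" for u
    by (simp_all add: T_def matrix_vector_mult_def sum_3 axis_def)
  have inj: "inj ((*v) T)"
  proof (rule injI)
    fix u u' assume "T *v u = T *v u'"
    then show "u = u'"
      using T(1-3)[of u] T(1-3)[of u'] by (simp add: vec_eq_iff forall_3)
  qed
  have range: "range ((*v) T) = plane p q r"
  proof
    show "plane p q r \<subseteq> range ((*v) T)"
    proof
      fix z assume "z \<in> plane p q r"
      then have "z = T *v (vector [z $ Z01, z $ Z02, z $ Z03])"
        by (simp add: pl_vec_eq_iff T plane_def)
      then show "z \<in> range ((*v) T)" by blast
    qed
  qed (auto simp: plane_def T)
  have "vec.dim (range ((*v) T)) = vec.dim (UNIV :: ('k ^ 3) set)"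
    by (intro vec.dim_image_eq) (use inj matrix_vector_mul_linear_gen in \<open>auto simp: inj_on_def\<close>)
  then have dim: "vec.dim (plane p q r) = 3"
    unfolding range vec_dim_card by simp
  have "det M = - (p * q * r)"
    by (simp add: det_3 M_def)
  then have inv: "invertible M"
    using assms by (simp add: invertible_det_nz)
  have sym: "transpose M = M"
    by (simp add: transpose_def M_def vec_eq_iff)
  have "(M *v u) $ 1 = p * u $ 1" "(M *v u) $ 2 = - q * u $ 2" "(M *v u) $ 3 = r * u $ 3" for u
    by (simp_all add: sum_3 matrix_vector_mult_def M_def)
  then have form: "(\<Sum>i\<in>UNIV. u $ i * (M *v u) $ i) = pfaffian (T *v u)" for u
    by (simp add: sum_3 pfaffian_def T algebra_simps)
  have nz: "T *v u = 0 \<longleftrightarrow> u = 0" for u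
    using inj by (metis injD matrix_vector_mult_0_right)
  have "pluecker ` lines_in (plane p q r)
      = {vec.span {T *v u} | u. u \<noteq> 0 \<and> (\<Sum>i\<in>UNIV. u $ i * (M *v u) $ i) = 0}"
    unfolding pluecker_lines_in_eq form range[symmetric] using nz by blast
  then show ?thesis
    unfolding conic_in_plane_def
    by (intro conjI exI[of _ T] exI[of _ M] subspace_plane dim inj range sym inv)
qed

definition plane_quadric :: "'k::field \<Rightarrow> 'k \<Rightarrow> 'k \<Rightarrow> 'k ^ 4 \<Rightarrow> 'k" where
  "plane_quadric p q r v =
     (v $ 0)\<^sup>2 - q * r * (v $ 1)\<^sup>2 + p * r * (v $ 2)\<^sup>2 - p * q * (v $ 3)\<^sup>2"

definition plane_pt :: "'k::field \<Rightarrow> 'k \<Rightarrow> 'k \<Rightarrow> 'k \<Rightarrow> 'k \<Rightarrow> 'k \<Rightarrow> 'k ^ pl_index" where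
  "plane_pt p q r x y w = (\<chi> z. case z of Z01 \<Rightarrow> x | Z02 \<Rightarrow> y | Z03 \<Rightarrow> w
       | Z12 \<Rightarrow> r * w | Z13 \<Rightarrow> q * y | Z23 \<Rightarrow> p * x)"

lemma plane_pt_nth [simp]:
  "plane_pt p q r x y w $ Z01 = x" "plane_pt p q r x y w $ Z02 = y"
  "plane_pt p q r x y w $ Z03 = w" "plane_pt p q r x y w $ Z12 = r * w"
  "plane_pt p q r x y w $ Z13 = q * y" "plane_pt p q r x y w $ Z23 = p * x"
  by (simp_all add: plane_pt_def)

lemma plane_pt_in_plane: "plane_pt p q r x y w \<in> plane p q r"
  by (simp add: plane_def)

lemma plane_eq_plane_pt:
  "z \<in> plane p q r \<Longrightarrow> z = plane_pt p q r (z $ Z01) (z $ Z02) (z $ Z03)"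
  by (simp add: pl_vec_eq_iff plane_def)

lemma contraction_plane_pt:
  "contraction (plane_pt p q r x y w) v = vec4
     (v $ 1 * x + v $ 2 * y + v $ 3 * w)
     (- v $ 0 * x + q * v $ 3 * y + r * v $ 2 * w)
     (p * v $ 3 * x - v $ 0 * y - r * v $ 1 * w)
     (- p * v $ 2 * x - q * v $ 1 * y - v $ 0 * w)"
  by (simp add: vec_4_eq_iff contraction_def algebra_simps)

text \<open>The product of the skew matrix of \<open>z\<close> with that of the dual two-form is, up to sign, the
  Pfaffian times the identity.\<close>

lemma pfaffian_annihilates_kernel:
  assumes "contraction z v = 0"
  shows "pfaffian z *s v = 0"
proof -
  let ?u = "contraction z v"
  have "pfaffian z *s v = vec4
     (- z $ Z23 * ?u $ 1 + z $ Z13 * ?u $ 2 - z $ Z12 * ?u $ 3)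
     (z $ Z23 * ?u $ 0 - z $ Z03 * ?u $ 2 + z $ Z02 * ?u $ 3)
     (- z $ Z13 * ?u $ 0 + z $ Z03 * ?u $ 1 - z $ Z01 * ?u $ 3)
     (z $ Z12 * ?u $ 0 - z $ Z02 * ?u $ 1 + z $ Z01 * ?u $ 2)"
    by (simp add: vec_4_eq_iff contraction_def pfaffian_def algebra_simps)
  then show ?thesis using assms by (simp add: vec_4_eq_iff)
qed

text \<open>Multiplying the equations of incidence by suitable coordinates of \<open>v\<close> and adding them up
  eliminates two of the three unknowns and leaves the quadratic form times the third one.\<close>

lemma plane_quadric_eq_0_if_contraction:
  assumes "contraction (plane_pt p q r x y w) v = 0" "plane_pt p q r x y w \<noteq> 0"
  shows "plane_quadric p q r v = 0"
proof -
  let ?Q = "plane_quadric p q r v"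
  define e0 where "e0 = v $ 1 * x + v $ 2 * y + v $ 3 * w"
  define e1 where "e1 = - v $ 0 * x + q * v $ 3 * y + r * v $ 2 * w"
  define e2 where "e2 = p * v $ 3 * x - v $ 0 * y - r * v $ 1 * w"
  define e3 where "e3 = - p * v $ 2 * x - q * v $ 1 * y - v $ 0 * w"
  have e: "e0 = 0" "e1 = 0" "e2 = 0" "e3 = 0"
    using assms(1) unfolding contraction_plane_pt e0_def e1_def e2_def e3_def
    by (simp_all only: vec_4_eq_iff vec4_nth zero_index)
  have "?Q * x = - q * r * v $ 1 * e0 - v $ 0 * e1 - q * v $ 3 * e2 - r * v $ 2 * e3"
    "?Q * y = p * r * v $ 2 * e0 - p * v $ 3 * e1 - v $ 0 * e2 + r * v $ 1 * e3"
    "?Q * w = - p * q * v $ 3 * e0 + p * v $ 2 * e1 + q * v $ 1 * e2 - v $ 0 * e3"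
    unfolding plane_quadric_def e0_def e1_def e2_def e3_def
    by (simp_all add: algebra_simps power2_eq_square)
  then have "?Q * x = 0" "?Q * y = 0" "?Q * w = 0"
    using e by simp_all
  moreover have "x \<noteq> 0 \<or> y \<noteq> 0 \<or> w \<noteq> 0"
    using assms(2) by (auto simp: pl_vec_eq_iff)
  ultimately show ?thesis by auto
qed

text \<open>The last three of the four equations of incidence form a \<open>3 \<times> 3\<close> system. The cross product of
  two of its rows solves it on the quadric, and every solution is a multiple of any nonzero such
  cross product. The three cross products are the columns \<open>(A, f, g)\<close>, \<open>(f', B, h)\<close>, \<open>(g', h', C)\<close>
  of the adjugate matrix. They do not all vanish: on the quadric the trace \<open>A + B + C\<close> is
  \<open>2 v\<^sub>0\<^sup>2\<close>, so that \<open>A = B = C = 0\<close> would imply \<open>v\<^sub>0 = 0\<close> and then \<open>v = 0\<close>.\<close>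

lemma line_of_plane_through_point:
  fixes p q r :: "'k::field" and v :: "'k ^ 4"
  assumes two: "(2::'k) \<noteq> 0" and pqr: "p \<noteq> 0" "q \<noteq> 0" "r \<noteq> 0"
    and v: "v \<noteq> 0" "plane_quadric p q r v = 0"
  obtains s where "s \<in> plane p q r" "s \<noteq> 0" "contraction s v = 0"
    "\<And>u. u \<in> plane p q r \<Longrightarrow> contraction u v = 0 \<Longrightarrow> \<exists>t. u = t *s s"
proof -
  note conclude = that
  let ?Q = "plane_quadric p q r v"
  define A where "A = (v $ 0)\<^sup>2 - q * r * (v $ 1)\<^sup>2"
  define B where "B = (v $ 0)\<^sup>2 + p * r * (v $ 2)\<^sup>2"
  define C where "C = (v $ 0)\<^sup>2 - p * q * (v $ 3)\<^sup>2"
  define f where "f = p * (r * v $ 1 * v $ 2 + v $ 0 * v $ 3)"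
  define f' where "f' = q * (v $ 0 * v $ 3 - r * v $ 1 * v $ 2)"
  define g where "g = - p * (q * v $ 1 * v $ 3 + v $ 0 * v $ 2)"
  define g' where "g' = r * (v $ 0 * v $ 2 - q * v $ 1 * v $ 3)"
  define h where "h = - q * (v $ 0 * v $ 1 + p * v $ 2 * v $ 3)"
  define h' where "h' = r * (p * v $ 2 * v $ 3 - v $ 0 * v $ 1)"
  note defs = A_def B_def C_def f_def g_def h_def f'_def g'_def h'_def
  have sol: "contraction (plane_pt p q r A f g) v = vec4 (v $ 1 * ?Q) (- v $ 0 * ?Q) 0 0"
    "contraction (plane_pt p q r f' B h) v = vec4 (v $ 2 * ?Q) 0 (- v $ 0 * ?Q) 0"
    "contraction (plane_pt p q r g' h' C) v = vec4 (v $ 3 * ?Q) 0 0 (- v $ 0 * ?Q)"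
    unfolding contraction_plane_pt defs plane_quadric_def
    by (simp_all add: vec_4_eq_iff algebra_simps power2_eq_square)
  have cross: "A * y = f * x \<and> A * w = g * x" "B * x = f' * y \<and> B * w = h * y"
    "C * x = g' * w \<and> C * y = h' * w"
    if "contraction (plane_pt p q r x y w) v = 0" for x y w
  proof -
    define e1 where "e1 = - v $ 0 * x + q * v $ 3 * y + r * v $ 2 * w"
    define e2 where "e2 = p * v $ 3 * x - v $ 0 * y - r * v $ 1 * w"
    define e3 where "e3 = - p * v $ 2 * x - q * v $ 1 * y - v $ 0 * w"
    have e: "e1 = 0" "e2 = 0" "e3 = 0"
      using that unfolding contraction_plane_pt e1_def e2_def e3_def
      by (simp_all only: vec_4_eq_iff vec4_nth zero_index)
    have "A * y - f * x = - v $ 0 * e2 + r * v $ 1 * e3"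
      "A * w - g * x = q * v $ 1 * e2 - v $ 0 * e3"
      "B * x - f' * y = - v $ 0 * e1 - r * v $ 2 * e3"
      "B * w - h * y = p * v $ 2 * e1 - v $ 0 * e3"
      "C * x - g' * w = - v $ 0 * e1 - q * v $ 3 * e2"
      "C * y - h' * w = - p * v $ 3 * e1 - v $ 0 * e2"
      unfolding defs e1_def e2_def e3_def by (simp_all add: algebra_simps power2_eq_square)
    then show "A * y = f * x \<and> A * w = g * x" "B * x = f' * y \<and> B * w = h * y"
      "C * x = g' * w \<and> C * y = h' * w"
      using e by simp_all
  qed
  have finish: thesis if s: "s \<in> plane p q r" "s \<noteq> 0" "contraction s v = 0"
    and u: "\<And>x y w. contraction (plane_pt p q r x y w) v = 0 \<Longrightarrow> \<exists>t. plane_pt p q r x y w = t *s s"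
    for s
  proof (rule conclude[OF s])
    fix u assume "u \<in> plane p q r" "contraction u v = 0"
    then show "\<exists>t. u = t *s s"
      using u plane_eq_plane_pt[of u p q r] by metis
  qed
  have "A + B + C = 2 * (v $ 0)\<^sup>2"
    using v(2) unfolding A_def B_def C_def plane_quadric_def by (simp add: algebra_simps)
  then have "v $ 0 = 0" if "A = 0" "B = 0" "C = 0"
    using two that by simp
  then have "A \<noteq> 0 \<or> B \<noteq> 0 \<or> C \<noteq> 0"
    using pqr v(1) by (auto simp: A_def B_def C_def vec_4_eq_iff)
  then consider "A \<noteq> 0" | "B \<noteq> 0" | "C \<noteq> 0" by blast
  then show thesis
  proof cases
    case 1
    show thesis
    proof (rule finish[of "plane_pt p q r A f g"])
      show "\<exists>t. plane_pt p q r x y w = t *s plane_pt p q r A f g"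
        if "contraction (plane_pt p q r x y w) v = 0" for x y w
        using cross(1)[OF that] 1 by (intro exI[of _ "x / A"]) (auto simp: pl_vec_eq_iff field_simps)
    qed (use 1 sol v in \<open>auto simp: plane_pt_in_plane pl_vec_eq_iff vec_4_eq_iff\<close>)
  next
    case 2
    show thesis
    proof (rule finish[of "plane_pt p q r f' B h"])
      show "\<exists>t. plane_pt p q r x y w = t *s plane_pt p q r f' B h"
        if "contraction (plane_pt p q r x y w) v = 0" for x y w
        using cross(2)[OF that] 2 by (intro exI[of _ "y / B"]) (auto simp: pl_vec_eq_iff field_simps)
    qed (use 2 sol v in \<open>auto simp: plane_pt_in_plane pl_vec_eq_iff vec_4_eq_iff\<close>)
  next
    case 3
    show thesis
    proof (rule finish[of "plane_pt p q r g' h' C"])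
      show "\<exists>t. plane_pt p q r x y w = t *s plane_pt p q r g' h' C"
        if "contraction (plane_pt p q r x y w) v = 0" for x y w
        using cross(3)[OF that] 3 by (intro exI[of _ "w / C"]) (auto simp: pl_vec_eq_iff field_simps)
    qed (use 3 sol v in \<open>auto simp: plane_pt_in_plane pl_vec_eq_iff vec_4_eq_iff\<close>)
  qed
qed

lemma contraction_scale: "contraction (t *s z) v = t *s contraction z v"
  by (simp add: vec_4_eq_iff contraction_def algebra_simps)

lemma proj_pointsE:
  assumes "P \<in> proj_points"
  obtains v where "v \<noteq> 0" "P = vec.span {v}"
proof -
  have P: "vec.subspace P" "vec.dim P = 1" using assms by (auto simp: proj_points_def)
  then obtain B where B: "vec.independent B" "vec.span B = P" "card B = 1"
    using vec.basis_subspace_exists by metis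
  then obtain v where v: "B = {v}" by (auto simp: card_1_singleton_iff)
  then have "v \<noteq> 0" using B by (auto simp: vec.dependent_zero)
  then show ?thesis using that B v by blast
qed

text \<open>The solution of the incidence equations at a point of the quadric is decomposable, because it
  has a nonzero kernel vector. So it is the Pluecker vector of a line, and the only one in the
  plane through that point.\<close>

lemma ruling_lines_in_plane:
  fixes p q r :: "'k::field"
  assumes "(2::'k) \<noteq> 0" "p \<noteq> 0" "q \<noteq> 0" "r \<noteq> 0"
  shows "ruling (lines_in (plane p q r)) (hypersurface (plane_quadric p q r))"
  unfolding ruling_def
proof (intro conjI ballI)
  show "lines_in (plane p q r) \<subseteq> proj_lines"
    unfolding lines_in_def using proj_lines_iff_zero_locus by blast
next
  fix L assume "L \<in> lines_in (plane p q r)"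
  then obtain l l' where l: "pl_coords l l' \<noteq> 0" "pl_coords l l' \<in> plane p q r"
    "L = zero_locus {l, l'}"
    by (auto simp: lines_in_def)
  have "plane_quadric p q r v = 0" if "v \<in> L" for v
  proof -
    have "contraction (pl_coords l l') v = 0"
      using that l by (simp add: zero_locus_eq_contraction_kernel)
    then show ?thesis
      using plane_quadric_eq_0_if_contraction l(1) plane_eq_plane_pt[OF l(2)] by metis
  qed
  then show "proj_space L \<subseteq> hypersurface (plane_quadric p q r)"
    by (auto simp: proj_space_def hypersurface_def)
next
  fix P assume P: "P \<in> hypersurface (plane_quadric p q r)"
  then obtain v where v: "v \<noteq> 0" "P = vec.span {v}"
    using proj_pointsE by (auto simp: hypersurface_def)
  have "plane_quadric p q r v = 0"
    using P v vec.span_base[of v "{v}"] by (auto simp: hypersurface_def)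
  then obtain s where s: "s \<in> plane p q r" "s \<noteq> 0" "contraction s v = 0"
    and uniq: "\<And>u. u \<in> plane p q r \<Longrightarrow> contraction u v = 0 \<Longrightarrow> \<exists>t. u = t *s s"
    using line_of_plane_through_point[OF assms v(1)] by blast
  have "pfaffian s = 0"
    using pfaffian_annihilates_kernel[OF s(3)] v(1) by (simp add: vec.scale_eq_0_iff)
  then obtain l l' where l: "pl_coords l l' = s"
    using decomposable_if_pfaffian_eq_0[OF s(2)] by blast
  have sub: "P \<subseteq> zero_locus {m, m'} \<longleftrightarrow> v \<in> zero_locus {m, m'}" for m m'
    using vec.span_minimal[OF _ subspace_zero_locus, of "{v}" "{m, m'}"]
      vec.span_base[of v "{v}"] v(2) by auto
  show "\<exists>!L. L \<in> lines_in (plane p q r) \<and> P \<subseteq> L"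
  proof (rule ex1I[of _ "zero_locus {l, l'}"])
    show "zero_locus {l, l'} \<in> lines_in (plane p q r) \<and> P \<subseteq> zero_locus {l, l'}"
    proof
      show "zero_locus {l, l'} \<in> lines_in (plane p q r)"
        unfolding lines_in_def using l s by blast
      have "v \<in> zero_locus {l, l'}"
        using l s by (simp add: zero_locus_eq_contraction_kernel)
      then show "P \<subseteq> zero_locus {l, l'}"
        using sub by blast
    qed
  next
    fix L assume "L \<in> lines_in (plane p q r) \<and> P \<subseteq> L"
    then obtain m m' where m: "pl_coords m m' \<noteq> 0" "pl_coords m m' \<in> plane p q r"
      "L = zero_locus {m, m'}" "v \<in> zero_locus {m, m'}"
      using sub by (auto simp: lines_in_def)
    then have "contraction (pl_coords m m') v = 0"
      by (simp add: zero_locus_eq_contraction_kernel)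
    then obtain t where t: "pl_coords m m' = t *s s"
      using uniq m(2) by blast
    then have "t \<noteq> 0"
      using m(1) by auto
    then show "L = zero_locus {l, l'}"
      using m(1,3) t l s(2) by (simp add: zero_locus_eq_contraction_kernel contraction_scale)
  qed
qed

section \<open>Commuting linear forms\<close>

text \<open>A factor without terms of degree less than two has its degree-two part multiplied only by the
  constant term of the other factor. This makes the kernels of linear functionals in degree two,
  within the elements of order at least two, two-sided ideals.\<close>

lemma lookup_mult_Word_pair_low_right:
  fixes f g :: "'k::field free_alg"
  assumes f: "f \<in> low_degree_free"
  shows "Poly_Mapping.lookup (g * f) (Word [i, j])
    = Poly_Mapping.lookup g (Word []) * Poly_Mapping.lookup f (Word [i, j])"
proof -
  have "(\<Sum>v. Poly_Mapping.lookup f v when Word [i, j] = u + v)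
      = (Poly_Mapping.lookup f (Word [i, j]) when u = Word [])" for u
  proof (cases "u = Word []")
    case True
    then have "Word [i, j] = u + v \<longleftrightarrow> v = Word [i, j]" for v
      by (cases v) (auto simp: plus_word_def)
    then show ?thesis using True by simp
  next
    case False
    have "Poly_Mapping.lookup f v = 0" if "Word [i, j] = u + v" for v
    proof (rule lookup_low[OF f])
      have "length (letters u) + length (letters v) = 2"
        using arg_cong[OF that, of "\<lambda>w. length (letters w)"] by (simp add: plus_word_def)
      moreover have "letters u \<noteq> []" using False by (cases u) auto
      ultimately show "length (letters v) \<le> 1"
        by (cases "letters u") auto
    qed
    then have "(\<lambda>v. Poly_Mapping.lookup f v when Word [i, j] = u + v) = (\<lambda>v. 0)"
      by (auto simp: when_def fun_eq_iff)
    then have "(\<Sum>v. Poly_Mapping.lookup f v when Word [i, j] = u + v) = 0"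
      by (simp only: Sum_any.neutral)
    then show ?thesis using False by simp
  qed
  then show ?thesis
    by (simp add: lookup_mult mult_when)
qed

lemma lookup_mult_Word_pair_low_left:
  fixes f g :: "'k::field free_alg"
  assumes f: "f \<in> low_degree_free"
  shows "Poly_Mapping.lookup (f * g) (Word [i, j])
    = Poly_Mapping.lookup f (Word [i, j]) * Poly_Mapping.lookup g (Word [])"
proof -
  have "Poly_Mapping.lookup f u * (\<Sum>v. Poly_Mapping.lookup g v when Word [i, j] = u + v)
      = (Poly_Mapping.lookup f (Word [i, j]) * Poly_Mapping.lookup g (Word []) when u = Word [i, j])" for u
  proof (cases "u = Word [i, j]")
    case True
    then have "Word [i, j] = u + v \<longleftrightarrow> v = Word []" for v
      by (cases v) (auto simp: plus_word_def)
    then show ?thesis using True by simp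
  next
    case False
    show ?thesis
    proof (cases "length (letters u) \<le> 1")
      case True
      then show ?thesis using lookup_low[OF f] False by simp
    next
      case long: False
      have "Word [i, j] \<noteq> u + v" for v
      proof
        assume "Word [i, j] = u + v"
        then have "letters u @ letters v = [i, j]"
          by (simp add: plus_word_def)
        then have "letters u = [i, j]"
          using long by (auto simp: append_eq_Cons_conv)
        then show False using False by (cases u) simp
      qed
      then show ?thesis using False by simp
    qed
  qed
  then show ?thesis
    by (simp add: lookup_mult)
qed

definition degree_two_kernel :: "'k::field ^ 4 ^ 4 \<Rightarrow> 'k free_alg set" where
  "degree_two_kernel c = {f \<in> low_degree_free.
     (\<Sum>i\<in>UNIV. \<Sum>j\<in>UNIV. c $ i $ j * Poly_Mapping.lookup f (Word [i, j])) = 0}"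

lemma ideal_degree_two_kernel: "ideal (degree_two_kernel c) ring_of_type_algebra"
proof (intro idealI ring_type_algebra)
  interpret R: ring "ring_of_type_algebra :: 'a free_alg ring"
    by (rule ring_type_algebra)
  have inv: "inv\<^bsub>add_monoid ring_of_type_algebra\<^esub> f = - f" for f :: "'a free_alg"
    using R.minus_equality[of "- f" f] by (simp add: a_inv_def)
  show "subgroup (degree_two_kernel c) (add_monoid ring_of_type_algebra)"
  proof (rule group.subgroupI[OF R.a_group])
    show "inv\<^bsub>add_monoid ring_of_type_algebra\<^esub> f \<in> degree_two_kernel c"
      if "f \<in> degree_two_kernel c" for f
      using that unfolding inv
      by (simp add: degree_two_kernel_def low_degree_free_def sum_negf)
    show "degree_two_kernel c \<noteq> {}"
      by (auto simp: degree_two_kernel_def low_degree_free_def intro!: exI[of _ 0])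
  qed (auto simp: degree_two_kernel_def low_degree_free_def lookup_add algebra_simps sum.distrib)
next
  fix f g :: "'a free_alg"
  assume "f \<in> degree_two_kernel c" 
  then have f: "f \<in> low_degree_free"
    "(\<Sum>i\<in>UNIV. \<Sum>j\<in>UNIV. c $ i $ j * Poly_Mapping.lookup f (Word [i, j])) = 0"
    by (auto simp: degree_two_kernel_def)
  let ?t = "Poly_Mapping.lookup g (Word [])"
  have "(\<Sum>i\<in>UNIV. \<Sum>j\<in>UNIV. c $ i $ j * (?t * Poly_Mapping.lookup f (Word [i, j])))
      = ?t * (\<Sum>i\<in>UNIV. \<Sum>j\<in>UNIV. c $ i $ j * Poly_Mapping.lookup f (Word [i, j]))"
    by (simp add: sum_distrib_left algebra_simps)
  then show "g \<otimes>\<^bsub>ring_of_type_algebra\<^esub> f \<in> degree_two_kernel c"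
    "f \<otimes>\<^bsub>ring_of_type_algebra\<^esub> g \<in> degree_two_kernel c"
    using f low_degree_free_mult[of f g] low_degree_free_mult[of g f]
    by (simp_all add: degree_two_kernel_def lookup_mult_Word_pair_low_right
        lookup_mult_Word_pair_low_left mult.commute[of _ ?t])
qed

text \<open>The homogeneous elements of degree two of the free algebra, as matrices.\<close>

definition quad :: "'k::field ^ 4 ^ 4 \<Rightarrow> 'k free_alg" where
  "quad m = (\<Sum>i\<in>UNIV. \<Sum>j\<in>UNIV. Poly_Mapping.single (Word [i, j]) (m $ i $ j))"

lemma quad_diff: "quad (m - m') = quad m - quad m'"
  by (simp add: quad_def single_diff sum_subtractf)

lemma quad_add: "quad (m + m') = quad m + quad m'"
  by (simp add: quad_def single_add sum.distrib)

lemma scalar_quad: "scalar t * quad m = quad (\<chi> i j. t * m $ i $ j)"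
  by (simp add: quad_def sum_distrib_left mult_single)

lemma linear_form_mult: "linear_form l * linear_form l' = quad (\<chi> i j. l $ i * l' $ j)"
  by (simp add: linear_form_def quad_def ygen_def sum_distrib_left sum_distrib_right mult_single
      plus_word_def zero_word_def) (rule sum.swap)

lemma lookup_quad: "Poly_Mapping.lookup (quad m) (Word [i, j]) = m $ i $ j"
proof -
  have "Poly_Mapping.lookup (quad m) (Word [i, j])
      = (\<Sum>a\<in>UNIV. if a = i then (\<Sum>b\<in>UNIV. if b = j then m $ a $ b else 0) else 0)"
    unfolding quad_def lookup_sum
    by (intro sum.cong refl) (auto simp: lookup_single when_def intro!: sum.neutral sum.cong)
  then show ?thesis by simp
qed

lemma quad_low_degree_free: "quad m \<in> low_degree_free"
  by (simp add: low_degree_free_def quad_def lookup_sum lookup_single)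

lemma ygen_linear_form: "ygen i = linear_form (axis i 1)"
proof -
  have "linear_form (axis i 1) = (\<Sum>j\<in>UNIV. if j = i then ygen j else 0)"
    unfolding linear_form_def
    by (intro sum.cong refl) (auto simp: axis_def ygen_def mult_single)
  also have "\<dots> = ygen i" by simp
  finally show ?thesis ..
qed

lemma ygen_mult_quad: "ygen i * ygen j = quad (\<chi> a b. axis i 1 $ a * axis j 1 $ b)"
  by (simp only: ygen_linear_form linear_form_mult)

definition relation_matrix :: "'k::field \<Rightarrow> 4 \<Rightarrow> 4 \<Rightarrow> 4 \<Rightarrow> 'k ^ 4 ^ 4" where
  "relation_matrix t i j k = (\<chi> a b.
     (axis 0 1 $ a * axis i 1 $ b - axis i 1 $ a * axis 0 1 $ b)
     - t * (axis j 1 $ a * axis k 1 $ b - axis k 1 $ a * axis j 1 $ b))"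

lemma quad_relation_matrix:
  "quad (relation_matrix t i j k) =
     (ygen 0 * ygen i - ygen i * ygen 0) - scalar t * (ygen j * ygen k - ygen k * ygen j)"
  unfolding ygen_mult_quad quad_diff[symmetric] scalar_quad
  by (rule arg_cong[of _ _ quad]) (simp add: relation_matrix_def vec_eq_iff)

lemma quad_relation_matrix_in_rel_ideal:
  "quad (relation_matrix \<alpha> 1 2 3) \<in> rel_ideal \<alpha> \<beta> \<gamma>"
  "quad (relation_matrix \<beta> 2 3 1) \<in> rel_ideal \<alpha> \<beta> \<gamma>"
  "quad (relation_matrix \<gamma> 3 1 2) \<in> rel_ideal \<alpha> \<beta> \<gamma>"
proof -
  have "relations \<alpha> \<beta> \<gamma> \<subseteq> rel_ideal \<alpha> \<beta> \<gamma>"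
    unfolding rel_ideal_def by (intro ring.genideal_self ring_type_algebra) simp
  then show "quad (relation_matrix \<alpha> 1 2 3) \<in> rel_ideal \<alpha> \<beta> \<gamma>"
    "quad (relation_matrix \<beta> 2 3 1) \<in> rel_ideal \<alpha> \<beta> \<gamma>"
    "quad (relation_matrix \<gamma> 3 1 2) \<in> rel_ideal \<alpha> \<beta> \<gamma>"
    unfolding quad_relation_matrix relations_def by auto
qed

text \<open>The functional sends \<open>[y\<^sub>j,y\<^sub>k]\<close> to \<open>2\<close> and \<open>[y\<^sub>0,y\<^sub>i]\<close> to \<open>2 t\<close>, and vanishes on all other
  commutators of generators and on all anticommutators. So with \<open>t = \<alpha>\<^sub>i\<close> it kills the defining
  relations, and it recovers the coefficient of \<open>[y\<^sub>j,y\<^sub>k]\<close> in \<open>A\<^sub>2\<close> up to the factor \<open>2\<close>.\<close>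

definition skew_functional :: "'k::field \<Rightarrow> 4 \<Rightarrow> 4 \<Rightarrow> 4 \<Rightarrow> 'k ^ 4 ^ 4" where
  "skew_functional t i j k = (\<chi> a b.
     (axis j 1 $ a * axis k 1 $ b - axis k 1 $ a * axis j 1 $ b)
     + t * (axis 0 1 $ a * axis i 1 $ b - axis i 1 $ a * axis 0 1 $ b))"

lemma quad_in_degree_two_kernel_iff:
  assumes "(i, j, k) \<in> {(1, 2, 3), (2, 3, 1), (3, 1, 2)}"
  shows "quad m \<in> degree_two_kernel (skew_functional t i j k) \<longleftrightarrow>
    m $ j $ k - m $ k $ j + t * (m $ 0 $ i - m $ i $ 0) = 0"
  using assms
  by (auto simp: degree_two_kernel_def skew_functional_def quad_low_degree_free lookup_quad
      sum_4_from_0 axis_def algebra_simps)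

lemma rel_ideal_subset_degree_two_kernel:
  assumes "(t, i, j, k) \<in> {(\<alpha>, 1, 2, 3), (\<beta>, 2, 3, 1), (\<gamma>, 3, 1, 2)}"
  shows "rel_ideal \<alpha> \<beta> \<gamma> \<subseteq> degree_two_kernel (skew_functional t i j k)"
  unfolding rel_ideal_def
proof (intro ring.genideal_minimal ring_type_algebra ideal_degree_two_kernel)
  have "(i, j, k) \<in> {(1, 2, 3), (2, 3, 1), (3, 1, 2)}"
    using assms by auto
  note quad = quad_in_degree_two_kernel_iff[OF this]
  have sym: "(ygen 0 * ygen i + ygen i * ygen 0) - (ygen j * ygen k + ygen k * ygen j)
    = quad (\<chi> a b. (axis 0 1 $ a * axis i 1 $ b + axis i 1 $ a * axis 0 1 $ b)
        - (axis j 1 $ a * axis k 1 $ b + axis k 1 $ a * axis j 1 $ b))" for i j k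
    unfolding ygen_mult_quad quad_diff[symmetric] quad_add[symmetric]
    by (rule arg_cong[of _ _ quad]) (simp add: vec_eq_iff)
  show "relations \<alpha> \<beta> \<gamma> \<subseteq> degree_two_kernel (skew_functional t i j k)"
  proof
    fix f assume "f \<in> relations \<alpha> \<beta> \<gamma>"
    then obtain t' i' j' k' where
      idx: "(t', i', j', k') \<in> {(\<alpha>, 1, 2, 3), (\<beta>, 2, 3, 1), (\<gamma>, 3, 1, 2)}"
      and "f = (ygen 0 * ygen i' - ygen i' * ygen 0) - scalar t' * (ygen j' * ygen k' - ygen k' * ygen j')
        \<or> f = (ygen 0 * ygen i' + ygen i' * ygen 0) - (ygen j' * ygen k' + ygen k' * ygen j')"
      unfolding relations_def by blast
    then consider "f = quad (relation_matrix t' i' j' k')"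
      | "f = quad (\<chi> a b. (axis 0 1 $ a * axis i' 1 $ b + axis i' 1 $ a * axis 0 1 $ b)
        - (axis j' 1 $ a * axis k' 1 $ b + axis k' 1 $ a * axis j' 1 $ b))"
      unfolding sym quad_relation_matrix[symmetric] by blast
    then show "f \<in> degree_two_kernel (skew_functional t i j k)"
    proof cases
      case 1
      then show ?thesis
        unfolding 1 quad using assms idx
        by (elim insertE emptyE) (simp_all add: relation_matrix_def axis_def)
    next
      case 2
      then show ?thesis
        unfolding 2 quad using assms idx
        by (elim insertE emptyE) (simp_all add: axis_def)
    qed
  qed
qed

text \<open>Modulo the relations \<open>[l,l']\<close> becomes
  \<open>(z\<^sub>2\<^sub>3 + \<alpha> z\<^sub>0\<^sub>1) [y\<^sub>2,y\<^sub>3] + (\<beta> z\<^sub>0\<^sub>2 - z\<^sub>1\<^sub>3) [y\<^sub>3,y\<^sub>1] + (z\<^sub>1\<^sub>2 + \<gamma> z\<^sub>0\<^sub>3) [y\<^sub>1,y\<^sub>2]\<close>. The skew functionals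
  show that its coefficients vanish if the commutator lies in the ideal; if they vanish, the
  commutator is the combination of the skew relations with coefficients \<open>z\<^sub>0\<^sub>1, z\<^sub>0\<^sub>2, z\<^sub>0\<^sub>3\<close>.\<close>

lemma commutator_in_rel_ideal_iff:
  fixes \<alpha> \<beta> \<gamma> :: "'k::field"
  assumes two: "(2::'k) \<noteq> 0"
  shows "linear_form l * linear_form l' - linear_form l' * linear_form l \<in> rel_ideal \<alpha> \<beta> \<gamma> \<longleftrightarrow>
    pl_coords l l' $ Z23 = - \<alpha> * pl_coords l l' $ Z01 \<and>
    pl_coords l l' $ Z13 = \<beta> * pl_coords l l' $ Z02 \<and>
    pl_coords l l' $ Z12 = - \<gamma> * pl_coords l l' $ Z03"
proof
  have comm: "linear_form l * linear_form l' - linear_form l' * linear_form l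
      = quad (\<chi> a b. minor l l' a b)"
    unfolding linear_form_mult quad_diff[symmetric]
    by (rule arg_cong[of _ _ quad]) (simp add: vec_eq_iff minor_def)
  {
    assume "linear_form l * linear_form l' - linear_form l' * linear_form l \<in> rel_ideal \<alpha> \<beta> \<gamma>"
    then have mem: "quad (\<chi> a b. minor l l' a b) \<in> rel_ideal \<alpha> \<beta> \<gamma>"
      by (simp only: comm)
    have key: "minor l l' j k + t * minor l l' 0 i = 0"
      if "(t, i, j, k) \<in> {(\<alpha>, 1, 2, 3), (\<beta>, 2, 3, 1), (\<gamma>, 3, 1, 2)}" for t i j k
    proof -
      have idx: "(i, j, k) \<in> {(1, 2, 3), (2, 3, 1), (3, 1, 2)}"
        using that by auto
      have "quad (\<chi> a b. minor l l' a b) \<in> degree_two_kernel (skew_functional t i j k)"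
        using rel_ideal_subset_degree_two_kernel[OF that] mem by blast
      then have "2 * (minor l l' j k + t * minor l l' 0 i) = 0"
        unfolding quad_in_degree_two_kernel_iff[OF idx]
        by (simp add: minor_swap[of l l' k j] minor_swap[of l l' i 0] algebra_simps)
      then show ?thesis using two by (simp only: mult_eq_0_iff) simp
    qed
    have "minor l l' 2 3 + \<alpha> * minor l l' 0 1 = 0" "minor l l' 3 1 + \<beta> * minor l l' 0 2 = 0"
      "minor l l' 1 2 + \<gamma> * minor l l' 0 3 = 0"
      by (rule key, simp)+
    then show "pl_coords l l' $ Z23 = - \<alpha> * pl_coords l l' $ Z01 \<and>
      pl_coords l l' $ Z13 = \<beta> * pl_coords l l' $ Z02 \<and>
      pl_coords l l' $ Z12 = - \<gamma> * pl_coords l l' $ Z03"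
      unfolding pl_coords_nth minor_swap[of l l' 1 3]
      by (simp add: eq_neg_iff_add_eq_0 neg_eq_iff_add_eq_0)
  next
    assume z: "pl_coords l l' $ Z23 = - \<alpha> * pl_coords l l' $ Z01 \<and>
      pl_coords l l' $ Z13 = \<beta> * pl_coords l l' $ Z02 \<and>
      pl_coords l l' $ Z12 = - \<gamma> * pl_coords l l' $ Z03"
    interpret I: ideal "rel_ideal \<alpha> \<beta> \<gamma>" "ring_of_type_algebra :: 'k free_alg ring"
      by (rule ideal_rel_ideal)
    have all: "\<forall>a b. minor l l' a b =
        minor l l' 0 1 * relation_matrix \<alpha> 1 2 3 $ a $ b
       + minor l l' 0 2 * relation_matrix \<beta> 2 3 1 $ a $ b
       + minor l l' 0 3 * relation_matrix \<gamma> 3 1 2 $ a $ b"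
    proof -
      have "minor l l' 2 3 = - \<alpha> * minor l l' 0 1" "minor l l' 1 3 = \<beta> * minor l l' 0 2"
        "minor l l' 1 2 = - \<gamma> * minor l l' 0 3" "minor l l' a a = 0" for a
        using z by (simp_all add: pl_coords_nth minor_def)
      then show ?thesis
        by (simp add: forall_4_from_0 relation_matrix_def axis_def minor_swap[of l l' 1 0]
            minor_swap[of l l' 2 0] minor_swap[of l l' 3 0] minor_swap[of l l' 2 1]
            minor_swap[of l l' 3 1] minor_swap[of l l' 3 2] mult.commute)
    qed
    have "quad (\<chi> a b. minor l l' a b)
      = scalar (minor l l' 0 1) * quad (relation_matrix \<alpha> 1 2 3)
       + scalar (minor l l' 0 2) * quad (relation_matrix \<beta> 2 3 1)
       + scalar (minor l l' 0 3) * quad (relation_matrix \<gamma> 3 1 2)"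
      unfolding scalar_quad quad_add[symmetric]
      by (rule arg_cong[of _ _ quad])
        (simp only: vec_eq_iff vec_lambda_beta vector_add_component, rule all)
    moreover have "scalar t * f \<in> rel_ideal \<alpha> \<beta> \<gamma>" if "f \<in> rel_ideal \<alpha> \<beta> \<gamma>" for t f
      using I.I_l_closed[OF that, of "scalar t"] by simp
    moreover have "f + g \<in> rel_ideal \<alpha> \<beta> \<gamma>" if "f \<in> rel_ideal \<alpha> \<beta> \<gamma>" "g \<in> rel_ideal \<alpha> \<beta> \<gamma>" for f g
      using additive_subgroup.a_closed[OF I.additive_subgroup_axioms that] by simp
    ultimately show "linear_form l * linear_form l' - linear_form l' * linear_form l \<in> rel_ideal \<alpha> \<beta> \<gamma>"
      unfolding comm using quad_relation_matrix_in_rel_ideal[where \<alpha> = \<alpha> and \<beta> = \<beta> and \<gamma> = \<gamma>] by simp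
  }
qed

lemma degree_one_commute_iff:
  "degree_one \<alpha> \<beta> \<gamma> l \<otimes>\<^bsub>alg_A \<alpha> \<beta> \<gamma>\<^esub> degree_one \<alpha> \<beta> \<gamma> l' =
   degree_one \<alpha> \<beta> \<gamma> l' \<otimes>\<^bsub>alg_A \<alpha> \<beta> \<gamma>\<^esub> degree_one \<alpha> \<beta> \<gamma> l \<longleftrightarrow>
   linear_form l * linear_form l' - linear_form l' * linear_form l \<in> rel_ideal \<alpha> \<beta> \<gamma>"
proof -
  interpret I: ideal "rel_ideal \<alpha> \<beta> \<gamma>" "ring_of_type_algebra :: 'a free_alg ring"
    by (rule ideal_rel_ideal)
  have minus: "f \<ominus>\<^bsub>ring_of_type_algebra\<^esub> g = f - g" for f g :: "'a free_alg"
    using I.minus_equality[of "- g" g] by (simp add: a_minus_def)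
  have mult: "degree_one \<alpha> \<beta> \<gamma> l \<otimes>\<^bsub>alg_A \<alpha> \<beta> \<gamma>\<^esub> degree_one \<alpha> \<beta> \<gamma> l'
      = rel_ideal \<alpha> \<beta> \<gamma> +>\<^bsub>ring_of_type_algebra\<^esub> (linear_form l * linear_form l')" for l l'
    using I.rcoset_mult_add[of "linear_form l" "linear_form l'"]
    by (simp add: degree_one_def alg_A_def FactRing_def)
  show ?thesis
    unfolding mult
    using I.quotient_eq_iff_same_a_r_cos[OF ideal_rel_ideal,
        of "linear_form l * linear_form l'" "linear_form l' * linear_form l"]
    by (simp add: minus)
qed

section \<open>The four families of lines\<close>

lemma commuting_subspace_iff:
  fixes \<alpha> \<beta> \<gamma> :: "'k::field"
  assumes "(2::'k) \<noteq> 0"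
  shows "commuting_subspace \<alpha> \<beta> \<gamma> U \<longleftrightarrow>
    (\<exists>l l'. U = vec.span {l, l'} \<and> pl_coords l l' \<noteq> 0 \<and> pl_coords l l' \<in> plane (- \<alpha>) \<beta> (- \<gamma>))"
proof -
  have "U = vec.span {l, l'} \<and> vec.dim U = 2 \<and> R \<longleftrightarrow> U = vec.span {l, l'} \<and> pl_coords l l' \<noteq> 0 \<and> R"
    for l l' R
    using dim_pair_eq_2_iff[of l l'] vec.dim_span[of "{l, l'}"] by auto
  then show ?thesis
    unfolding commuting_subspace_def degree_one_commute_iff commutator_in_rel_ideal_iff[OF assms]
    by (simp only: plane_def mem_Collect_eq)
qed

text \<open>Applied with \<open>f = \<psi>\<^sub>j\<close>: how a linear automorphism of the forms transports a family of lines is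
  determined by what it does to Pluecker vectors.\<close>

lemma zero_loci_of_images:
  fixes f :: "'k::field ^ 4 \<Rightarrow> 'k ^ 4"
  assumes lin: "\<And>s t l l'. f (s *s l + t *s l') = s *s f l + t *s f l'" and "surj f"
    and transf: "\<And>l l'. pl_coords (f l) (f l') \<noteq> 0 \<and> pl_coords (f l) (f l') \<in> W'
      \<longleftrightarrow> pl_coords l l' \<noteq> 0 \<and> pl_coords l l' \<in> W"
  shows "{zero_locus (f ` U) | U. \<exists>l l'. U = vec.span {l, l'} \<and> pl_coords l l' \<noteq> 0 \<and> pl_coords l l' \<in> W}
    = lines_in W'"
proof -
  have img: "zero_locus (f ` vec.span {l, l'}) = zero_locus {f l, f l'}" for l l'
  proof -
    have "f ` vec.span {l, l'} = vec.span {f l, f l'}"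
    proof
      show "f ` vec.span {l, l'} \<subseteq> vec.span {f l, f l'}"
        unfolding span_pair using lin by blast
      show "vec.span {f l, f l'} \<subseteq> f ` vec.span {l, l'}"
        unfolding span_pair using lin[symmetric] by blast
    qed
    then show ?thesis by (simp only: zero_locus_span)
  qed
  show ?thesis
  proof
    show "{zero_locus (f ` U) | U. \<exists>l l'. U = vec.span {l, l'} \<and> pl_coords l l' \<noteq> 0 \<and> pl_coords l l' \<in> W}
      \<subseteq> lines_in W'"
    proof clarify
      fix l l' assume "pl_coords l l' \<noteq> 0" "pl_coords l l' \<in> W"
      then show "zero_locus (f ` vec.span {l, l'}) \<in> lines_in W'"
        unfolding img lines_in_def using transf by blast
    qed
    show "lines_in W' \<subseteq> {zero_locus (f ` U) | U.
      \<exists>l l'. U = vec.span {l, l'} \<and> pl_coords l l' \<noteq> 0 \<and> pl_coords l l' \<in> W}"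
    proof
      fix L assume "L \<in> lines_in W'"
      then obtain m m' where m: "pl_coords m m' \<noteq> 0" "pl_coords m m' \<in> W'" "L = zero_locus {m, m'}"
        unfolding lines_in_def by blast
      obtain l l' where "m = f l" "m' = f l'"
        using \<open>surj f\<close> by (meson surjD)
      then have "L = zero_locus (f ` vec.span {l, l'})" "pl_coords l l' \<noteq> 0" "pl_coords l l' \<in> W"
        using m transf img by auto
      then show "L \<in> {zero_locus (f ` U) | U.
        \<exists>l l'. U = vec.span {l, l'} \<and> pl_coords l l' \<noteq> 0 \<and> pl_coords l l' \<in> W}"
        by blast
    qed
  qed
qed

lemma psi_eq:
  "psi a b c ii 0 l = l"
  "psi a b c ii 1 l = vec4 (- l $ 1) (ii * b * c * l $ 0) (- ii * c * l $ 3) (- b * l $ 2)"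
  "psi a b c ii 2 l = vec4 (- l $ 2) (c * l $ 3) (ii * a * c * l $ 0) (ii * a * l $ 1)"
  "psi a b c ii 3 l = vec4 (- ii * l $ 3) (- b * l $ 2) (- ii * a * l $ 1) (a * b * l $ 0)"
  by (simp_all add: psi_def linear_ext_def vec_4_eq_iff axis_def Let_def algebra_simps)

lemma psi_linear:
  "psi a b c ii j (s *s l + t *s l') = s *s psi a b c ii j l + t *s psi a b c ii j l'"
  by (simp add: psi_def linear_ext_def Let_def vec_eq_iff algebra_simps)

lemma surj_psi:
  fixes a b c ii :: "'k::field"
  assumes "a \<noteq> 0" "b \<noteq> 0" "c \<noteq> 0" "ii \<noteq> 0"
  shows "surj (psi a b c ii j)"
proof (rule surjI)
  fix m :: "'k ^ 4"
  define g where "g j = (if j = 0 then m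
     else if j = 1 then vec4 (m $ 1 / (ii * b * c)) (- m $ 0) (- m $ 3 / b) (- m $ 2 / (ii * c))
     else if j = 2 then vec4 (m $ 2 / (ii * a * c)) (m $ 3 / (ii * a)) (- m $ 0) (m $ 1 / c)
     else vec4 (m $ 3 / (a * b)) (- m $ 2 / (ii * a)) (- m $ 1 / b) (- m $ 0 / ii))" for j :: 4
  have "\<forall>j. psi a b c ii j (g j) = m"
    using assms by (simp add: forall_4_from_0 psi_eq g_def vec_4_eq_iff)
  then show "psi a b c ii j (g j) = m" ..
qed

lemma eq_iff_scaled_eq:
  fixes k x y z w :: "'k::field"
  shows "k \<noteq> 0 \<Longrightarrow> x - y = k * (z - w) \<Longrightarrow> x = y \<longleftrightarrow> z = w"
  by (metis eq_iff_diff_eq_0 mult_eq_0_iff)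

text \<open>The \<open>p, q, r\<close> for which the conic \<open>C\<^sub>j\<close> lies in \<open>plane p q r\<close>. The coefficients of \<open>Q\<^sub>j\<close> are
  then \<open>1, - q r, p r, - p q\<close>.\<close>

definition plane_coeffs :: "'k::field \<Rightarrow> 'k \<Rightarrow> 'k \<Rightarrow> 4 \<Rightarrow> 'k \<times> 'k \<times> 'k" where
  "plane_coeffs \<alpha> \<beta> \<gamma> j = (if j = 0 then (- \<alpha>, \<beta>, - \<gamma>) else if j = 1 then (\<alpha>, - 1, - 1)
     else if j = 2 then (- 1, - \<beta>, 1) else (1, 1, \<gamma>))"

lemma imaginary_unit_mult:
  fixes ii :: "'k::field"
  assumes "ii\<^sup>2 = - 1"
  shows "ii * ii = - 1" "ii * (ii * x) = - x"
  using assms by (simp_all add: power2_eq_square flip: mult.assoc)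

lemma pl_coords_psi:
  fixes a b c ii :: "'k::field"
  assumes "ii\<^sup>2 = - 1"
  defines "z \<equiv> \<lambda>j l l'. pl_coords (psi a b c ii j l) (psi a b c ii j l')"
  shows
    "z 1 l l' $ Z01 = ii * b * c * pl_coords l l' $ Z01" "z 1 l l' $ Z23 = - ii * b * c * pl_coords l l' $ Z23"
    "z 1 l l' $ Z02 = ii * c * pl_coords l l' $ Z13" "z 1 l l' $ Z13 = - ii * b\<^sup>2 * c * pl_coords l l' $ Z02"
    "z 1 l l' $ Z03 = b * pl_coords l l' $ Z12" "z 1 l l' $ Z12 = b * c\<^sup>2 * pl_coords l l' $ Z03"
    "z 2 l l' $ Z01 = - c * pl_coords l l' $ Z23" "z 2 l l' $ Z23 = - a\<^sup>2 * c * pl_coords l l' $ Z01"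
    "z 2 l l' $ Z02 = ii * a * c * pl_coords l l' $ Z02" "z 2 l l' $ Z13 = - ii * a * c * pl_coords l l' $ Z13"
    "z 2 l l' $ Z03 = ii * a * pl_coords l l' $ Z12" "z 2 l l' $ Z12 = - ii * a * c\<^sup>2 * pl_coords l l' $ Z03"
    "z 3 l l' $ Z01 = - ii * b * pl_coords l l' $ Z23" "z 3 l l' $ Z23 = ii * a\<^sup>2 * b * pl_coords l l' $ Z01"
    "z 3 l l' $ Z02 = a * pl_coords l l' $ Z13" "z 3 l l' $ Z13 = a * b\<^sup>2 * pl_coords l l' $ Z02"
    "z 3 l l' $ Z03 = ii * a * b * pl_coords l l' $ Z03" "z 3 l l' $ Z12 = - ii * a * b * pl_coords l l' $ Z12"
  unfolding z_def pl_coords_nth minor_def psi_eq vec4_nth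
  by (simp_all add: power2_eq_square algebra_simps imaginary_unit_mult[OF assms(1)])

text \<open>As \<open>\<psi>\<^sub>j\<close> permutes the Pluecker coordinates up to nonzero factors, each equation of the plane
  with index \<open>j\<close>, evaluated at the image, is a nonzero multiple of the corresponding equation
  of the plane with index \<open>0\<close>. The factors are the constants \<open>k\<close> below.\<close>

lemma pl_coords_psi_in_plane_iff:
  fixes a b c ii :: "'k::field"
  assumes nz: "a \<noteq> 0" "b \<noteq> 0" "c \<noteq> 0" and ii: "ii\<^sup>2 = - 1"
    and pqr: "plane_coeffs (a\<^sup>2) (b\<^sup>2) (c\<^sup>2) j = (p, q, r)"
  shows "pl_coords (psi a b c ii j l) (psi a b c ii j l') \<noteq> 0 \<and>
      pl_coords (psi a b c ii j l) (psi a b c ii j l') \<in> plane p q r \<longleftrightarrow>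
    pl_coords l l' \<noteq> 0 \<and> pl_coords l l' \<in> plane (- a\<^sup>2) (b\<^sup>2) (- c\<^sup>2)"
proof -
  let ?m = "psi a b c ii j l" and ?m' = "psi a b c ii j l'"
  have "ii \<noteq> 0" using ii by auto
  note nz = nz this
  note coords = pl_coords_psi[OF ii]
  consider "j = 0" | "j = 1" | "j = 2" | "j = 3"
    using UNIV_4_from_0 by blast
  then have "(pl_coords ?m ?m' = 0 \<longleftrightarrow> pl_coords l l' = 0) \<and>
    (pl_coords ?m ?m' \<in> plane p q r \<longleftrightarrow> pl_coords l l' \<in> plane (- a\<^sup>2) (b\<^sup>2) (- c\<^sup>2))"
  proof cases
    case 1
    then show ?thesis using pqr by (simp add: plane_coeffs_def psi_eq)
  next
    case 2
    then have pqr: "p = a\<^sup>2" "q = - 1" "r = - 1"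
      using pqr by (auto simp: plane_coeffs_def)
    show ?thesis
      unfolding 2 pqr plane_def mem_Collect_eq
    proof (intro conjI arg_cong2[of _ _ _ _ "(\<and>)"])
      show "pl_coords (psi a b c ii 1 l) (psi a b c ii 1 l') = 0 \<longleftrightarrow> pl_coords l l' = 0"
        unfolding pl_vec_eq_iff coords using nz by auto
    next
      show "pl_coords (psi a b c ii 1 l) (psi a b c ii 1 l') $ Z23 = a\<^sup>2 * pl_coords (psi a b c ii 1 l) (psi a b c ii 1 l') $ Z01 \<longleftrightarrow>
        pl_coords l l' $ Z23 = - a\<^sup>2 * pl_coords l l' $ Z01"
        by (rule eq_iff_scaled_eq[where k = "- ii * b * c"])
          (use nz in \<open>simp_all add: coords algebra_simps\<close>)
      show "pl_coords (psi a b c ii 1 l) (psi a b c ii 1 l') $ Z13 = - 1 * pl_coords (psi a b c ii 1 l) (psi a b c ii 1 l') $ Z02 \<longleftrightarrow>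
        pl_coords l l' $ Z13 = b\<^sup>2 * pl_coords l l' $ Z02"
        by (rule eq_iff_scaled_eq[where k = "ii * c"])
          (use nz in \<open>simp_all add: coords algebra_simps\<close>)
      show "pl_coords (psi a b c ii 1 l) (psi a b c ii 1 l') $ Z12 = - 1 * pl_coords (psi a b c ii 1 l) (psi a b c ii 1 l') $ Z03 \<longleftrightarrow>
        pl_coords l l' $ Z12 = - c\<^sup>2 * pl_coords l l' $ Z03"
        by (rule eq_iff_scaled_eq[where k = "b"])
          (use nz in \<open>simp_all add: coords algebra_simps\<close>)
    qed
  next
    case 3
    then have pqr: "p = - 1" "q = - b\<^sup>2" "r = 1"
      using pqr by (auto simp: plane_coeffs_def)
    show ?thesis
      unfolding 3 pqr plane_def mem_Collect_eq
    proof (intro conjI arg_cong2[of _ _ _ _ "(\<and>)"])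
      show "pl_coords (psi a b c ii 2 l) (psi a b c ii 2 l') = 0 \<longleftrightarrow> pl_coords l l' = 0"
        unfolding pl_vec_eq_iff coords using nz by auto
    next
      show "pl_coords (psi a b c ii 2 l) (psi a b c ii 2 l') $ Z23 = - 1 * pl_coords (psi a b c ii 2 l) (psi a b c ii 2 l') $ Z01 \<longleftrightarrow>
        pl_coords l l' $ Z23 = - a\<^sup>2 * pl_coords l l' $ Z01"
        by (rule eq_iff_scaled_eq[where k = "- c"])
          (use nz in \<open>simp_all add: coords algebra_simps\<close>)
      show "pl_coords (psi a b c ii 2 l) (psi a b c ii 2 l') $ Z13 = - b\<^sup>2 * pl_coords (psi a b c ii 2 l) (psi a b c ii 2 l') $ Z02 \<longleftrightarrow>
        pl_coords l l' $ Z13 = b\<^sup>2 * pl_coords l l' $ Z02"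
        by (rule eq_iff_scaled_eq[where k = "- ii * a * c"])
          (use nz in \<open>simp_all add: coords algebra_simps\<close>)
      show "pl_coords (psi a b c ii 2 l) (psi a b c ii 2 l') $ Z12 = 1 * pl_coords (psi a b c ii 2 l) (psi a b c ii 2 l') $ Z03 \<longleftrightarrow>
        pl_coords l l' $ Z12 = - c\<^sup>2 * pl_coords l l' $ Z03"
        by (rule eq_iff_scaled_eq[where k = "- ii * a"])
          (use nz in \<open>simp_all add: coords algebra_simps\<close>)
    qed
  next
    case 4
    then have pqr: "p = 1" "q = 1" "r = c\<^sup>2"
      using pqr by (auto simp: plane_coeffs_def)
    show ?thesis
      unfolding 4 pqr plane_def mem_Collect_eq
    proof (intro conjI arg_cong2[of _ _ _ _ "(\<and>)"])
      show "pl_coords (psi a b c ii 3 l) (psi a b c ii 3 l') = 0 \<longleftrightarrow> pl_coords l l' = 0"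
        unfolding pl_vec_eq_iff coords using nz by auto
    next
      show "pl_coords (psi a b c ii 3 l) (psi a b c ii 3 l') $ Z23 = 1 * pl_coords (psi a b c ii 3 l) (psi a b c ii 3 l') $ Z01 \<longleftrightarrow>
        pl_coords l l' $ Z23 = - a\<^sup>2 * pl_coords l l' $ Z01"
        by (rule eq_iff_scaled_eq[where k = "ii * b"])
          (use nz in \<open>simp_all add: coords algebra_simps\<close>)
      show "pl_coords (psi a b c ii 3 l) (psi a b c ii 3 l') $ Z13 = 1 * pl_coords (psi a b c ii 3 l) (psi a b c ii 3 l') $ Z02 \<longleftrightarrow>
        pl_coords l l' $ Z13 = b\<^sup>2 * pl_coords l l' $ Z02"
        by (rule eq_iff_scaled_eq[where k = "- a"])
          (use nz in \<open>simp_all add: coords algebra_simps\<close>)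
      show "pl_coords (psi a b c ii 3 l) (psi a b c ii 3 l') $ Z12 = c\<^sup>2 * pl_coords (psi a b c ii 3 l) (psi a b c ii 3 l') $ Z03 \<longleftrightarrow>
        pl_coords l l' $ Z12 = - c\<^sup>2 * pl_coords l l' $ Z03"
        by (rule eq_iff_scaled_eq[where k = "- ii * a * b"])
          (use nz in \<open>simp_all add: coords algebra_simps\<close>)
    qed
  qed
  then show ?thesis by blast
qed

lemma lines_C_eq_lines_in_plane:
  fixes a b c ii :: "'k::field"
  assumes "(2::'k) \<noteq> 0" "a \<noteq> 0" "b \<noteq> 0" "c \<noteq> 0" "ii\<^sup>2 = - 1"
    and "plane_coeffs (a\<^sup>2) (b\<^sup>2) (c\<^sup>2) j = (p, q, r)"
  shows "lines_C (a\<^sup>2) (b\<^sup>2) (c\<^sup>2) a b c ii j = lines_in (plane p q r)"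
proof -
  have "ii \<noteq> 0" using assms(5) by auto
  then show ?thesis
    unfolding lines_C_def commuting_subspace_iff[OF assms(1)]
    using assms by (intro zero_loci_of_images psi_linear surj_psi pl_coords_psi_in_plane_iff)
qed

section \<open>The points of the torsion sets\<close>

lemma proj_pt_in_hypersurface:
  assumes "t0 \<noteq> 0" "t0\<^sup>2 - q * r * t1\<^sup>2 + p * r * t2\<^sup>2 - p * q * t3\<^sup>2 = 0"
  shows "proj_pt t0 t1 t2 t3 \<in> hypersurface (plane_quadric p q r)"
proof -
  have nz: "vec4 t0 t1 t2 t3 \<noteq> 0"
    using assms(1) by (auto simp: vec_4_eq_iff)
  have "plane_quadric p q r w = 0" if w: "w \<in> vec.span {vec4 t0 t1 t2 t3}" for w
  proof -
    obtain s where "w = s *s vec4 t0 t1 t2 t3"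
      using w by (auto simp: vec.span_singleton)
    then have "plane_quadric p q r w = s\<^sup>2 * (t0\<^sup>2 - q * r * t1\<^sup>2 + p * r * t2\<^sup>2 - p * q * t3\<^sup>2)"
      by (simp add: plane_quadric_def power_mult_distrib algebra_simps)
    then show ?thesis using assms(2) by simp
  qed
  then show ?thesis
    using nz by (simp add: hypersurface_def proj_points_def proj_pt_def)
qed

text \<open>The squares of the coordinates that the four points of \<open>\<PP>\<^sub>i\<close> have in common.\<close>

definition torsion_squares :: "'k::field \<Rightarrow> 'k \<Rightarrow> 'k \<Rightarrow> 4 \<Rightarrow> 'k \<times> 'k \<times> 'k \<times> 'k" where
  "torsion_squares \<alpha> \<beta> \<gamma> i =
     (if i = 0 then (1, 1, 1, 1) else if i = 1 then (\<beta> * \<gamma>, - 1, - \<beta>, \<gamma>)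
      else if i = 2 then (\<alpha> * \<gamma>, \<alpha>, - 1, - \<gamma>) else (\<alpha> * \<beta>, - \<alpha>, \<beta>, - 1))"

lemma torsion_squares_on_quadric:
  assumes "i \<noteq> j" "plane_coeffs \<alpha> \<beta> \<gamma> j = (p, q, r)" "torsion_squares \<alpha> \<beta> \<gamma> i = (s0, s1, s2, s3)"
  shows "s0 - q * r * s1 + p * r * s2 - p * q * s3 = 0"
proof -
  have "\<forall>i j. i \<noteq> j \<longrightarrow> (case plane_coeffs \<alpha> \<beta> \<gamma> j of (p, q, r) \<Rightarrow>
      case torsion_squares \<alpha> \<beta> \<gamma> i of (s0, s1, s2, s3) \<Rightarrow>
        s0 - q * r * s1 + p * r * s2 - p * q * s3 = 0)"
    by (simp add: forall_4_from_0 plane_coeffs_def torsion_squares_def)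
  then show ?thesis using assms by fastforce
qed

lemma torsion_pts_subset_quadric:
  fixes a b c ii :: "'k::field"
  assumes nz: "a \<noteq> 0" "b \<noteq> 0" "c \<noteq> 0" and ii: "ii\<^sup>2 = - 1"
    and pqr: "plane_coeffs (a\<^sup>2) (b\<^sup>2) (c\<^sup>2) j = (p, q, r)" and "i \<noteq> j"
  shows "torsion_pts a b c ii i \<subseteq> hypersurface (plane_quadric p q r)"
proof -
  have pt: "proj_pt t0 t1 t2 t3 \<in> hypersurface (plane_quadric p q r)"
    if "t0 \<noteq> 0" "torsion_squares (a\<^sup>2) (b\<^sup>2) (c\<^sup>2) i = (t0\<^sup>2, t1\<^sup>2, t2\<^sup>2, t3\<^sup>2)" for t0 t1 t2 t3
    using that torsion_squares_on_quadric[OF \<open>i \<noteq> j\<close> pqr] by (simp add: proj_pt_in_hypersurface)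
  consider "i = 0" | "i = 1" | "i = 2" | "i = 3"
    using UNIV_4_from_0 by blast
  then show ?thesis
    by cases (simp_all add: torsion_pts_def pt torsion_squares_def nz ii power_mult_distrib)
qed

lemma ruling_covers_torsion_pts:
  assumes "ruling R Q" and "\<forall>i. i \<noteq> j \<longrightarrow> torsion_pts a b c ii i \<subseteq> Q"
  shows "pts_P a b c ii - (pts_infty \<union> torsion_pts a b c ii j) \<subseteq> Q"
    and "\<forall>P \<in> pts_P a b c ii - (pts_infty \<union> torsion_pts a b c ii j). \<exists>!L. L \<in> R \<and> P \<subseteq> L"
proof -
  show sub: "pts_P a b c ii - (pts_infty \<union> torsion_pts a b c ii j) \<subseteq> Q"
  proof
    fix P assume "P \<in> pts_P a b c ii - (pts_infty \<union> torsion_pts a b c ii j)"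
    then obtain i where "P \<in> torsion_pts a b c ii i" "i \<noteq> j"
      unfolding pts_P_def by blast
    then show "P \<in> Q"
      using assms(2) by blast
  qed
  show "\<forall>P \<in> pts_P a b c ii - (pts_infty \<union> torsion_pts a b c ii j). \<exists>!L. L \<in> R \<and> P \<subseteq> L"
    using assms(1) sub unfolding ruling_def by blast
qed

section \<open>Conics, rulings and torsion points\<close>

theorem corollary8p3:
  fixes \<alpha> \<beta> \<gamma> a b c ii :: "'k::alg_closed_field"
    and W :: "4 \<Rightarrow> ('k ^ pl_index) set"
    and Q :: "4 \<Rightarrow> ('k ^ 4) set set"
  assumes "CHAR('k) \<noteq> 2" and "CHAR('k) \<noteq> 3"
    and "\<alpha> \<notin> {0, 1, -1}" and "\<beta> \<notin> {0, 1, -1}" and "\<gamma> \<notin> {0, 1, -1}"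
    and "\<alpha> + \<beta> + \<gamma> + \<alpha> * \<beta> * \<gamma> = 0"
    and "a^2 = \<alpha>" and "b^2 = \<beta>" and "c^2 = \<gamma>" and "ii^2 = -1"
    and "W 0 = {z. z $ Z23 + \<alpha> * z $ Z01 = 0 \<and> z $ Z13 - \<beta> * z $ Z02 = 0 \<and> z $ Z12 + \<gamma> * z $ Z03 = 0}"
    and "W 1 = {z. z $ Z23 - \<alpha> * z $ Z01 = 0 \<and> z $ Z13 + z $ Z02 = 0 \<and> z $ Z12 + z $ Z03 = 0}"
    and "W 2 = {z. z $ Z23 + z $ Z01 = 0 \<and> z $ Z13 + \<beta> * z $ Z02 = 0 \<and> z $ Z12 - z $ Z03 = 0}"
    and "W 3 = {z. z $ Z23 - z $ Z01 = 0 \<and> z $ Z13 - z $ Z02 = 0 \<and> z $ Z12 - \<gamma> * z $ Z03 = 0}"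
    and "Q 0 = hypersurface (\<lambda>p. (p $ 0)^2 + \<beta> * \<gamma> * (p $ 1)^2 + \<gamma> * \<alpha> * (p $ 2)^2 + \<alpha> * \<beta> * (p $ 3)^2)"
    and "Q 1 = hypersurface (\<lambda>p. (p $ 0)^2 - (p $ 1)^2 - \<alpha> * (p $ 2)^2 + \<alpha> * (p $ 3)^2)"
    and "Q 2 = hypersurface (\<lambda>p. (p $ 0)^2 + \<beta> * (p $ 1)^2 - (p $ 2)^2 - \<beta> * (p $ 3)^2)"
    and "Q 3 = hypersurface (\<lambda>p. (p $ 0)^2 - \<gamma> * (p $ 1)^2 + \<gamma> * (p $ 2)^2 - (p $ 3)^2)"
  defines "C \<equiv> lines_C \<alpha> \<beta> \<gamma> a b c ii"
  shows "\<forall>j.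
      pluecker ` C j = grassmannian \<inter> proj_space (W j) \<and>
      conic_in_plane (W j) (pluecker ` C j) \<and>
      ruling (C j) (Q j) \<and>
      pts_P a b c ii - (pts_infty \<union> torsion_pts a b c ii j) \<subseteq> Q j \<and>
      (\<forall>P \<in> pts_P a b c ii - (pts_infty \<union> torsion_pts a b c ii j). \<exists>!L. L \<in> C j \<and> P \<subseteq> L)"
proof (rule allI)
  fix j :: 4
  have two: "(2::'k) \<noteq> 0"
  proof
    assume "(2::'k) = 0"
    then have "CHAR('k) dvd 2"
      using of_nat_eq_0_iff_char_dvd[of 2, where 'a = 'k] by simp
    then have "CHAR('k) = 1"
      using \<open>CHAR('k) \<noteq> 2\<close> prime_nat_iff[of 2] by auto
    then show False
      using of_nat_CHAR[where 'a = 'k] by simp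
  qed
  have nz: "a \<noteq> 0" "b \<noteq> 0" "c \<noteq> 0"
    using assms(3-5,7-9) by auto
  obtain p q r where pqr: "plane_coeffs (a\<^sup>2) (b\<^sup>2) (c\<^sup>2) j = (p, q, r)"
    by (metis prod.exhaust)
  have pqr_nz: "p \<noteq> 0" "q \<noteq> 0" "r \<noteq> 0"
    using pqr nz by (auto simp: plane_coeffs_def split: if_splits)
  have W: "W j = plane p q r"
  proof -
    have "\<forall>j. W j = (case plane_coeffs (a\<^sup>2) (b\<^sup>2) (c\<^sup>2) j of (p, q, r) \<Rightarrow> plane p q r)"
      unfolding forall_4_from_0 assms(11-14)
      using assms(7-9) by (auto simp: plane_coeffs_def plane_def eq_neg_iff_add_eq_0)
    then show ?thesis using pqr by simp
  qed
  have Q: "Q j = hypersurface (plane_quadric p q r)"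
  proof -
    have "\<forall>j. Q j = (case plane_coeffs (a\<^sup>2) (b\<^sup>2) (c\<^sup>2) j of (p, q, r) \<Rightarrow> hypersurface (plane_quadric p q r))"
      unfolding forall_4_from_0 assms(15-18)
      using assms(7-9) by (simp add: plane_coeffs_def plane_quadric_def[abs_def] mult.commute)
    then show ?thesis using pqr by simp
  qed
  have C: "C j = lines_in (plane p q r)"
    using lines_C_eq_lines_in_plane[OF two nz assms(10) pqr] assms(7-9) by (simp add: C_def)
  have ruling: "ruling (C j) (Q j)"
    unfolding C Q using two pqr_nz by (rule ruling_lines_in_plane)
  have "\<forall>i. i \<noteq> j \<longrightarrow> torsion_pts a b c ii i \<subseteq> Q j"
    unfolding Q using torsion_pts_subset_quadric[OF nz assms(10) pqr] by blast
  note torsion = ruling_covers_torsion_pts[OF ruling this]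
  show "pluecker ` C j = grassmannian \<inter> proj_space (W j) \<and>
      conic_in_plane (W j) (pluecker ` C j) \<and>
      ruling (C j) (Q j) \<and>
      pts_P a b c ii - (pts_infty \<union> torsion_pts a b c ii j) \<subseteq> Q j \<and>
      (\<forall>P \<in> pts_P a b c ii - (pts_infty \<union> torsion_pts a b c ii j). \<exists>!L. L \<in> C j \<and> P \<subseteq> L)"
  proof (intro conjI)
    show "pluecker ` C j = grassmannian \<inter> proj_space (W j)"
      unfolding C W by (rule pluecker_lines_in[OF subspace_plane])
    show "conic_in_plane (W j) (pluecker ` C j)"
      unfolding C W using pqr_nz by (rule conic_in_plane_lines_in_plane)
  qed (rule ruling torsion)+
qed

end
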